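(* As $n \to \infty$, $$f(n,4,5) = \frac{5}{6}\, n + o(n),$$ that is, $\displaystyle\lim_{n\to\infty} \frac{f(n,4,5)}{n} = \frac{5}{6}$, where $f(n,4,5)$ denotes the minimum number of colors in an edge-coloring of the complete graph $K_n$ such that every $4$-clique of $K_n$ has at least $5$ distinct colors among its six edges.
   Context: Fix integers $p, q$ with $p \ge 3$ and $2 \le q \le \binom{p}{2}$. A $(p,q)$-coloring of $K_n$ is a coloring of the edges of the complete graph $K_n$ on $n$ vertices (not required to be proper) such that every $p$-clique (the complete subgraph on any $p$ distinct vertices) has at least $q$ distinct colors among its edges. The Erdős–Gyárfás function $f(n,p,q)$ is the minimum number of colors such that $K_n$ has a $(p,q)$-coloring using that many colors. *)

theory Defs
  imports Complex_Main "HOL-Library.Ramsey"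
begin

text \<open>
  The complete graph on \<open>n\<close> vertices has vertex set \<open>{..<n}\<close> and edge set \<open>nsets {..<n} 2\<close>; a
  \<open>p\<close>-clique is given by its vertex set, an element of \<open>nsets {..<n} p\<close>.  Values of a colouring
  outside \<open>nsets {..<n} 2\<close> are irrelevant.
\<close>

definition pq_coloring :: "nat \<Rightarrow> nat \<Rightarrow> nat \<Rightarrow> (nat set \<Rightarrow> nat) \<Rightarrow> bool" where
  "pq_coloring n p q c \<longleftrightarrow> (\<forall>S \<in> nsets {..<n} p. q \<le> card (c ` nsets S 2))"

definition num_colors :: "nat \<Rightarrow> (nat set \<Rightarrow> nat) \<Rightarrow> nat" where
  "num_colors n c = card (c ` nsets {..<n} 2)"

definition erdos_gyarfas :: "nat \<Rightarrow> nat \<Rightarrow> nat \<Rightarrow> nat" where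
  "erdos_gyarfas n p q = (LEAST k. \<exists>c. pq_coloring n p q c \<and> num_colors n c = k)"

text \<open>The minimum is over a nonempty set, hence attained, whenever \<open>q \<le> p choose 2\<close>.\<close>

lemma pq_coloring_exists:
  assumes "q \<le> p choose 2"
  shows "\<exists>c. pq_coloring n p q c"
proof -
  have "finite (nsets {..<n} 2)"
    by (simp add: finite_imp_finite_nsets)
  then obtain c :: "nat set \<Rightarrow> nat" where c: "inj_on c (nsets {..<n} 2)"
    by (metis finite_imp_inj_to_nat_seg)
  have "q \<le> card (c ` nsets S 2)" if S: "S \<in> nsets {..<n} p" for S
  proof -
    have "nsets S 2 \<subseteq> nsets {..<n} 2"
      using S by (intro nsets_mono) (auto simp: nsets_def)
    then have "card (c ` nsets S 2) = card (nsets S 2)"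
      by (intro card_image inj_on_subset[OF c])
    moreover have "card S = p"
      using S by (simp add: nsets_def)
    ultimately show ?thesis
      using assms by simp
  qed
  then show ?thesis
    unfolding pq_coloring_def by blast
qed

lemma erdos_gyarfas_attained:
  assumes "q \<le> p choose 2"
  shows "\<exists>c. pq_coloring n p q c \<and> num_colors n c = erdos_gyarfas n p q"
  unfolding erdos_gyarfas_def
  by (rule LeastI_ex) (use pq_coloring_exists[OF assms] in blast)

end

theory Submission
  imports Defs "HOL-Computational_Algebra.Primes"
begin

text \<open>
  Call two adjacent edges of the same colour a cherry. In a \<open>(4,5)\<close>-colouring a vertex in \<open>p\<close> cherries as the
  apex sees at least \<open>n - 1 - p\<close> colours, and the triangles spanned by the cherries are edge-disjoint; this
  gives the lower bound. For the upper bound one needs nearly all edges in such triangles, and no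
  alternating 4-cycles \<open>ab, cd\<close> and \<open>bc, da\<close>. Bose's triple systems on \<open>\<int>/w \<times> \<int>/3\<close> with \<open>w = 3 ^ r\<close> give an
  explicit colouring of the complete graph on \<open>3 w\<close> vertices with about \<open>5 w / 2\<close> colours in which alternating
  4-cycles are the only defect. Their number does not matter, because they disappear in a blow-up: replace
  each vertex by a product of cyclic groups and add to the colour of an edge affine forms in the two
  group elements. Each bad 4-cycle is assigned its own coordinate, in which the two equations defining a lifted
  bad cycle are made contradictory, whereas within one cherry the coefficients \<open>1\<close> and \<open>2\<close> prevent new
  defects. The edges inside the blown-up vertices need only four further colours per group element, up to
  a constant, when one of the cyclic groups is large and the others are fixed.
\<close>

section \<open>Colourings of arbitrary finite vertex sets\<close>

text \<open>Five colours on six edges leave room for one coincidence. The clauses separate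
  coincidences of adjacent edges, governed mainly by the pattern, from double coincidences of
  opposite edges, which the blow-up removes. \<open>C a c\<close> is left out of the list because it
  equals \<open>C a b\<close>.\<close>

definition at_most_one_repetition :: "'v set \<Rightarrow> ('v \<Rightarrow> 'v \<Rightarrow> 'c) \<Rightarrow> bool" where
  "at_most_one_repetition V C \<longleftrightarrow>
     (\<forall>a\<in>V. \<forall>b\<in>V. \<forall>c\<in>V. \<forall>d\<in>V. distinct [a, b, c, d] \<longrightarrow>
        (C a b = C a c \<longrightarrow> distinct [C a b, C b c, C a d, C b d, C c d]) \<and>
        \<not> (C a b = C c d \<and> C b c = C d a))"

lemma image_nsets_4:
  assumes "distinct [x, y, z, t]"
  shows "c ` nsets {x, y, z, t} 2 = {c {x,y}, c {x,z}, c {x,t}, c {y,z}, c {y,t}, c {z,t}}"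
proof -
  have "nsets {x, y, z, t} 2 = {{x,y}, {x,z}, {x,t}, {y,z}, {y,t}, {z,t}}"
    using assms by (auto simp: nsets_2_eq)
  then show ?thesis by simp
qed

lemma card_ge_if_distinct:
  assumes "distinct xs" "set xs \<subseteq> A" "finite A"
  shows "length xs \<le> card A"
  using card_mono[OF assms(3,2)] distinct_card[OF assms(1)] by simp

text \<open>Without a coincidence of adjacent edges only the three pairs of opposite edges can
  coincide, and two coinciding pairs form an alternating 4-cycle.\<close>

lemma five_le_card_if:
  assumes sym: "\<And>a b. a \<in> V \<Longrightarrow> b \<in> V \<Longrightarrow> C a b = C b a"
    and V: "x \<in> V" "y \<in> V" "z \<in> V" "t \<in> V" "distinct [x, y, z, t]"
    and C: "at_most_one_repetition V C"
  shows "5 \<le> card {C x y, C x z, C x t, C y z, C y t, C z t}" (is "5 \<le> card ?S")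
proof -
  have star: "distinct [C a b, C b c, C a d, C b d, C c d]"
    if "C a b = C a c" "{a,b,c,d} \<subseteq> V" "distinct [a, b, c, d]" for a b c d
    using C that unfolding at_most_one_repetition_def by blast
  have opp: "\<not> (C a b = C c d \<and> C b c = C d a)"
    if "{a,b,c,d} \<subseteq> V" "distinct [a, b, c, d]" for a b c d
    using C that unfolding at_most_one_repetition_def by blast
  have five: "5 \<le> card ?S" if "distinct [p1, p2, p3, p4, p5]" "set [p1, p2, p3, p4, p5] \<subseteq> ?S"
    for p1 p2 p3 p4 p5
    using card_ge_if_distinct[OF that] by simp
  have *: "5 \<le> card ?S" if "C a b = C a c" "{a,b,c,d} = {x,y,z,t}" "distinct [a, b, c, d]" for a b c d
  proof (rule five[OF star[OF that(1)]])
    show "{a, b, c, d} \<subseteq> V" using that(2) V by auto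
    show "distinct [a, b, c, d]" by fact
    have "\<And>u v. u \<in> {x,y,z,t} \<Longrightarrow> v \<in> {x,y,z,t} \<Longrightarrow> u \<noteq> v \<Longrightarrow> C u v \<in> ?S"
      using sym V by auto
    then show "set [C a b, C b c, C a d, C b d, C c d] \<subseteq> ?S"
      using that(2,3) by auto
  qed
  show ?thesis
  proof (cases "\<exists>a b c d. C a b = C a c \<and> {a,b,c,d} = {x,y,z,t} \<and> distinct [a, b, c, d]")
    case True
    then show ?thesis using * by blast
  next
    case False
    then have no: "C a b \<noteq> C a c" if "{a,b,c,d} = {x,y,z,t}" "distinct [a, b, c, d]" for a b c d
      using that by blast
    have no': "C x y \<noteq> C x z" "C x y \<noteq> C x t" "C x y \<noteq> C y z" "C x y \<noteq> C y t"
      "C x z \<noteq> C x t" "C x z \<noteq> C y z" "C x z \<noteq> C z t" "C x t \<noteq> C y t" "C x t \<noteq> C z t"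
      "C y z \<noteq> C y t" "C y z \<noteq> C z t" "C y t \<noteq> C z t"
      using no[of x y z t] no[of x y t z] no[of y x z t] no[of y x t z] no[of x z t y] no[of z x y t]
        no[of z x t y] no[of t x y z] no[of t x z y] no[of y z t x] no[of z y t x] no[of t y z x]
        sym V by auto
    have opp': "\<not> (C x y = C z t \<and> C x t = C y z)" "\<not> (C x y = C z t \<and> C x z = C y t)"
      "\<not> (C x z = C y t \<and> C x t = C y z)"
      using opp[of x y z t] opp[of x y t z] opp[of x z y t] sym V by auto
    show ?thesis
    proof (cases "C x y = C z t")
      case True
      then show ?thesis
        using no' opp' by (intro five[of "C x y" "C x z" "C x t" "C y z" "C y t"]) auto
    next
      case xy: False
      show ?thesis
      proof (cases "C x z = C y t")
        case True
        then show ?thesis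
          using no' opp' xy by (intro five[of "C x y" "C z t" "C x t" "C y z" "C y t"]) auto
      next
        case False
        then show ?thesis
          using no' opp' xy by (intro five[of "C x y" "C z t" "C x t" "C x z" "C y t"]) auto
      qed
    qed
  qed
qed

text \<open>Embedding the vertices into \<open>V\<close> and numbering the colours by
  \<open>h\<close> allows any vertex and colour types; surplus vertices of \<open>V\<close> do no
  harm.\<close>

lemma erdos_gyarfas_le:
  fixes C :: "'v \<Rightarrow> 'v \<Rightarrow> 'c"
  assumes sym: "\<And>x y. x \<in> V \<Longrightarrow> y \<in> V \<Longrightarrow> C x y = C y x"
    and V: "finite V" "n \<le> card V"
    and C: "at_most_one_repetition V C"
    and fin: "finite \<Gamma>"
    and \<Gamma>: "\<And>x y. x \<in> V \<Longrightarrow> y \<in> V \<Longrightarrow> x \<noteq> y \<Longrightarrow> C x y \<in> \<Gamma>"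
  shows "erdos_gyarfas n 4 5 \<le> card \<Gamma>"
proof -
  obtain f where f: "f ` {..<n} \<subseteq> V" "inj_on f {..<n}"
    using card_le_inj[of "{..<n}" V] V by auto
  obtain h :: "'c \<Rightarrow> nat" where h: "inj_on h \<Gamma>"
    using finite_imp_inj_to_nat_seg[OF fin] by blast
  define c where "c S = h (C (f (Min S)) (f (Max S)))" for S
  have fin': "f x \<in> V" if "x < n" for x using f that by auto
  have c: "c {x, y} = h (C (f x) (f y))" if "x < n" "y < n" for x y
    using that by (cases "x \<le> y") (auto simp: c_def sym fin' max_def min_def)
  have fneq: "f x = f y \<longleftrightarrow> x = y" if "x < n" "y < n" for x y
    using f that by (auto simp: inj_on_def)
  have "5 \<le> card (c ` nsets S 2)" if "S \<in> nsets {..<n} 4" for S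
  proof -
    from that obtain x y z t where S: "S = {x,y,z,t}" "distinct [x,y,z,t]" "x<n" "y<n" "z<n" "t<n"
      by (auto simp: nsets_4_eq)
    let ?D = "{C (f x) (f y), C (f x) (f z), C (f x) (f t), C (f y) (f z), C (f y) (f t), C (f z) (f t)}"
    have "c ` nsets S 2 = h ` ?D"
      unfolding S(1) image_nsets_4[OF S(2)] using S by (simp add: c)
    moreover have "card (h ` ?D) = card ?D"
      using S by (intro card_image inj_on_subset[OF h]) (auto intro!: \<Gamma> fin' simp: fneq)
    moreover have "5 \<le> card ?D"
      by (rule five_le_card_if[OF sym _ _ _ _ _ C]) (use S in \<open>auto intro!: fin' simp: fneq\<close>)
    ultimately show ?thesis by simp
  qed
  then have "pq_coloring n 4 5 c" by (simp add: pq_coloring_def)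
  then have "erdos_gyarfas n 4 5 \<le> num_colors n c"
    unfolding erdos_gyarfas_def by (intro Least_le) blast
  also have "c ` nsets {..<n} 2 \<subseteq> h ` \<Gamma>"
    by (auto simp: nsets_2_eq c fneq intro!: \<Gamma> fin' imageI)
  then have "num_colors n c \<le> card \<Gamma>"
    unfolding num_colors_def
    using card_mono[of "h ` \<Gamma>"] card_image_le[OF fin, of h] fin by (meson finite_imageI le_trans)
  finally show ?thesis .
qed

section \<open>The lower bound\<close>

text \<open>The given coincidence leaves only five values for the six edges, so these must all
  differ.\<close>

lemma pq_coloring_4_5_star:
  assumes pq: "pq_coloring n 4 5 c" and lt: "v < n" "x < n" "y < n" "z < n"
    and d: "distinct [v, x, y, z]" and eq: "c {v, x} = c {v, y}"
  shows "distinct [c {v,x}, c {x,y}, c {v,z}, c {x,z}, c {y,z}]"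
proof -
  let ?xs = "[c {v,x}, c {x,y}, c {v,z}, c {x,z}, c {y,z}]"
  have "{v,x,y,z} \<in> nsets {..<n} 4"
    using lt d by (auto simp: nsets_def)
  then have "5 \<le> card (c ` nsets {v,x,y,z} 2)"
    using pq by (auto simp: pq_coloring_def)
  also have "c ` nsets {v,x,y,z} 2 = set ?xs"
    unfolding image_nsets_4[OF d] using eq by auto
  finally show ?thesis
    by (intro card_distinct) (metis card_length le_antisym length_Cons list.size(3) numeral_eq_Suc pred_numeral_simps(3) BitM.simps eval_nat_numeral)
qed

text \<open>The triangles spanned by monochromatic cherries are edge-disjoint, so there are at most
  \<open>n (n - 1) / 6\<close> cherries; a vertex sees at least \<open>n - 1\<close> colours minus the number of cherries at it.\<close>

lemma erdos_gyarfas_4_5_ge: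
  assumes n: "4 \<le> n"
  shows "5 * (n - 1) \<le> 6 * erdos_gyarfas n 4 5"
proof -
  obtain c where pq: "pq_coloring n 4 5 c" and num: "num_colors n c = erdos_gyarfas n 4 5"
    using erdos_gyarfas_attained[of 5 4 n] by (auto simp: choose_two)
  define P where "P v = {(x, y). x < y \<and> y < n \<and> x \<noteq> v \<and> y \<noteq> v \<and> c {v, x} = c {v, y}}" for v
  define S where "S = (SIGMA v:{..<n}. P v)"
  have finP: "finite (P v)" for v
    by (rule finite_subset[of _ "{..<n} \<times> {..<n}"]) (auto simp: P_def)
  have finS: "finite S" by (simp add: S_def finP)
  note star = pq_coloring_4_5_star[OF pq]
  have fourth: "\<exists>z<n. z \<notin> {v,x,y}" for v x y
  proof -
    have "card {v,x,y} < card {..<n}" using n by (simp add: card_insert_if)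
    then show ?thesis by (metis card_mono finite.emptyI finite.insertI lessThan_iff not_le subsetI)
  qed
  have star3: "c {v,x} \<noteq> c {x,y}" if "v < n" "x < n" "y < n" "distinct [v,x,y]" "c {v,x} = c {v,y}" for v x y
    using star[of v x y] fourth[of v x y] that by fastforce
  have deg: "n - 1 \<le> erdos_gyarfas n 4 5 + card (P v)" if v: "v < n" for v
  proof -
    let ?N = "{..<n} - {v}"
    \<comment> \<open>Dropping the smaller end of every cherry at \<open>v\<close> leaves at most
      one edge of each colour at \<open>v\<close>.\<close>
    let ?D = "fst ` P v"
    have "inj_on (\<lambda>x. c {v, x}) (?N - ?D)"
    proof (rule inj_onI)
      fix x y assume *: "x \<in> ?N - ?D" "y \<in> ?N - ?D" "c {v,x} = c {v,y}"
      then have "(x,y) \<notin> P v" "(y,x) \<notin> P v" by force+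
      then show "x = y" using * unfolding P_def by (cases x y rule: linorder_cases) auto
    qed
    then have "card (?N - ?D) = card ((\<lambda>x. c {v, x}) ` (?N - ?D))"
      by (simp add: card_image)
    also have "\<dots> \<le> num_colors n c"
      unfolding num_colors_def using v
      by (intro card_mono) (auto simp: finite_imp_finite_nsets intro!: imageI)
    finally have "card (?N - ?D) \<le> erdos_gyarfas n 4 5" using num by simp
    moreover have "card ?N - card ?D \<le> card (?N - ?D)"
      by (rule diff_card_le_card_Diff) (simp add: finP)
    moreover have "card ?D \<le> card (P v)" by (rule card_image_le[OF finP])
    moreover have "card ?N = n - 1" using v by simp
    ultimately show ?thesis by linarith
  qed
  define cherry where "cherry v x y \<longleftrightarrow> v < n \<and> x < n \<and> y < n \<and> distinct [v, x, y] \<and> c {v, x} = c {v, y}"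
    for v x y
  have sym: "cherry v y x" if "cherry v x y" for v x y
    using that by (auto simp: cherry_def)
  \<comment> \<open>The next four facts give edge-disjointness: a leg has one partner, it is neither
    a base nor a leg seen from its other end, and a base has one apex.\<close>
  have uniq: "y = z" if "cherry v x y" "cherry v x z" for v x y z
    using that star[of v x y z] by (auto simp: cherry_def)
  have no_base: "\<not> cherry x y z" if "cherry v x y" for v x y z
    using that star[of v x y z] star3[of v x y]
    by (cases "z = v") (auto simp: cherry_def insert_commute)
  have no_path: "\<not> cherry x v z" if "cherry v x y" for v x y z
    using that star[of v x y z] star3[of v x y]
    by (cases "z = y") (auto simp: cherry_def insert_commute)
  have apex: "v = w" if "cherry v x y" "cherry w x y" for v w x y
    using that star[of v x y w] by (auto simp: cherry_def insert_commute)
  have "3 * card S \<le> n choose 2"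
  proof -
    have S: "cherry v x y" "x < y" if "(v, x, y) \<in> S" for v x y
      using that by (auto simp: S_def P_def cherry_def)
    define E where "E = (\<lambda>(k::nat, v, x, y). if k = 0 then {v, x} else if k = 1 then {v, y} else {x, y::nat})"
    have E: "p = p' \<and> k = k'"
      if "p \<in> S" "p' \<in> S" "k < 3" "k' < 3" "E (k, p) = E (k', p')" for k k' p p'
    proof -
      obtain v x y v' x' y' where p: "p = (v, x, y)" "p' = (v', x', y')"
        by (metis surj_pair)
      have s: "cherry v x y" "x < y" "cherry v' x' y'" "x' < y'"
        using S that p by auto
      note rules = sym uniq no_base no_path apex less_asym
      have "k \<in> {0, 1, 2}" "k' \<in> {0, 1, 2}" using that by auto
      then consider "k = 0" "k' = 0" | "k = 0" "k' = 1" | "k = 0" "k' = 2"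
        | "k = 1" "k' = 0" | "k = 1" "k' = 1" | "k = 1" "k' = 2"
        | "k = 2" "k' = 0" | "k = 2" "k' = 1" | "k = 2" "k' = 2" by blast
      then show ?thesis
        by cases (use that(5) s in \<open>simp add: p E_def doubleton_eq_iff; metis rules\<close>)+
    qed
    have "inj_on E ({..<3} \<times> S)"
      by (rule inj_onI) (use E in force)
    then have "card (E ` ({..<3} \<times> S)) = 3 * card S"
      by (simp add: card_image card_cartesian_product)
    moreover have "E ` ({..<3} \<times> S) \<subseteq> nsets {..<n} 2"
      by (auto simp: E_def S_def P_def)
    then have "card (E ` ({..<3} \<times> S)) \<le> card (nsets {..<n} 2)"
      by (intro card_mono) (auto simp: finite_imp_finite_nsets)
    ultimately show ?thesis by simp
  qed
  moreover have "n * (n - 1) \<le> n * erdos_gyarfas n 4 5 + card S"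
  proof -
    have "(\<Sum>v<n. n - 1) \<le> (\<Sum>v<n. erdos_gyarfas n 4 5 + card (P v))"
      by (rule sum_mono) (use deg in auto)
    then show ?thesis by (simp add: sum.distrib S_def card_SigmaI finP)
  qed
  moreover have "2 * (n choose 2) \<le> n * (n - 1)"
    unfolding choose_two by (rule times_div_less_eq_dividend)
  ultimately have "n * (5 * (n - 1)) \<le> n * (6 * erdos_gyarfas n 4 5)"
    by (simp add: algebra_simps)
  then show ?thesis using n by simp
qed

section \<open>Lifting a pattern\<close>

text \<open>Coprimality to 6 makes the factors 1 to 4, which arise when linear congruences are
  combined, invertible.\<close>

definition modulus_ok :: "int \<Rightarrow> bool" where
  "modulus_ok N \<longleftrightarrow> 0 < N \<and> odd N \<and> \<not> 3 dvd N"

lemma modulus_ok_coprime: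
  assumes "modulus_ok N" "k \<in> {1, 2, 3, 4}"
  shows "coprime N k"
proof -
  have 2: "coprime N 2" using assms by (auto simp: modulus_ok_def)
  have "coprime N (2 * 2)" using 2 by (intro coprime_mult_right_iff[THEN iffD2]) auto
  moreover have "prime (3::int)" by simp
  then have "coprime N 3" using assms prime_imp_coprime[of 3 N] by (auto simp: modulus_ok_def coprime_commute)
  ultimately show ?thesis using 2 assms(2) by auto
qed

lemma modulus_ok_cancel:
  assumes "modulus_ok N" "\<bar>k\<bar> \<in> {1, 2, 3, 4}" "N dvd k * (u - v)"
    and "u \<in> {0..<N}" "v \<in> {0..<N}"
  shows "u = v"
proof -
  have "coprime N k"
    using modulus_ok_coprime[OF assms(1,2)] by simp
  then have "N dvd u - v"
    using assms(3) coprime_dvd_mult_right_iff by blast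
  moreover have "\<bar>u - v\<bar> < \<bar>N\<bar>" using assms(4,5) by auto
  ultimately show ?thesis
    using dvd_imp_le_int[of "u - v" N] by fastforce
qed

text \<open>The argument \<open>0 < x < N / 2\<close> represents a pair of residues \<open>\<plusminus>x\<close> modulo \<open>N\<close>. On such pairs doubling
  acts by \<open>x \<mapsto> 2 * x\<close> below \<open>N / 4\<close> and by \<open>x \<mapsto> N - 2 * x\<close> above, and the latter
  exchanges the two sides of \<open>N / 3\<close>; hence the thresholds.\<close>

definition doubling_label :: "int \<Rightarrow> int \<Rightarrow> nat" where
  "doubling_label N x =
     (if 3 * x > N then 3 else if 4 * x > N then 2 else multiplicity 2 x mod 2)"

lemma doubling_label_le: "doubling_label N x \<le> 3"
  by (simp add: doubling_label_def) linarith

text \<open>The relation forces \<open>y = 2 * x\<close> or \<open>y = N - 2 * x\<close>. In the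
  first case the parity of the 2-adic valuation flips unless \<open>y\<close> is already above
  \<open>N / 4\<close>, where \<open>x\<close> is not; in the second, \<open>x\<close> and
  \<open>y\<close> lie on different sides of \<open>N / 3\<close>.\<close>

lemma doubling_label_neq:
  assumes N: "modulus_ok N" and x: "0 < x" "2 * x < N" and y: "0 < y" "2 * y < N"
    and dvd: "N dvd 2 * x - y \<or> N dvd 2 * x + y"
  shows "doubling_label N x \<noteq> doubling_label N y"
proof -
  have N3: "N \<noteq> 3 * x" "N \<noteq> 3 * y" "N \<noteq> 4 * x" "N \<noteq> 4 * y"
    using N by (auto simp: modulus_ok_def)
  have "y = 2 * x \<or> y = N - 2 * x"
    using dvd
  proof
    assume "N dvd 2 * x - y"
    moreover have "\<bar>2 * x - y\<bar> < \<bar>N\<bar>" using x y by linarith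
    ultimately show ?thesis using dvd_imp_le_int[of "2 * x - y" N] by fastforce
  next
    assume "N dvd 2 * x + y"
    then have "N dvd 2 * x + y - N" by simp
    moreover have "\<bar>2 * x + y - N\<bar> < \<bar>N\<bar>" using x y by linarith
    ultimately show ?thesis using dvd_imp_le_int[of "2 * x + y - N" N] by fastforce
  qed
  then show ?thesis
  proof
    assume "y = 2 * x"
    moreover have "multiplicity 2 (2 * x) = Suc (multiplicity 2 x)"
      using x by (intro multiplicity_times_same) auto
    moreover have "m mod 2 \<noteq> Suc m mod 2" for m :: nat by presburger
    ultimately show ?thesis
      using x y N3 by (auto simp: doubling_label_def)
  next
    assume "y = N - 2 * x"
    moreover have "m mod 2 \<noteq> 3" "m mod 2 \<noteq> 2" for m :: nat by presburger+
    ultimately show ?thesis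
      using x y N3 by (auto simp: doubling_label_def)
  qed
qed

text \<open>The conditions say that a 4-clique containing two adjacent edges of equal colour has at least
  five colours; alternating 4-cycles \<open>\<kappa> a b = \<kappa> c d\<close>, \<open>\<kappa> b c = \<kappa> d a\<close> are still permitted.\<close>

locale pattern =
  fixes K :: "'k set" and \<kappa> :: "'k \<Rightarrow> 'k \<Rightarrow> 't"
  assumes finite_K: "finite K"
    and \<kappa>_sym: "\<kappa> a b = \<kappa> b a"
    and triangle: "\<lbrakk>a \<in> K; b \<in> K; c \<in> K; distinct [a, b, c]; \<kappa> a b = \<kappa> a c\<rbrakk> \<Longrightarrow> \<kappa> b c \<noteq> \<kappa> a b"
    and star: "\<lbrakk>a \<in> K; b \<in> K; c \<in> K; d \<in> K; distinct [a, b, c, d]; \<kappa> a b = \<kappa> a c\<rbrakk>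
      \<Longrightarrow> distinct [\<kappa> a b, \<kappa> b c, \<kappa> a d, \<kappa> b d, \<kappa> c d]"

section \<open>The blow-up and its colouring\<close>

text \<open>Inside a fibre, \<open>Inner\<close> serves ends that differ at \<open>z\<close> and is
  shared by all fibres; \<open>Fibre\<close> serves ends that agree at \<open>z\<close> and names
  its fibre, at a cost independent of \<open>N z\<close>.\<close>

datatype ('k, 't, 'i) colour =
    Cross 't "'i \<Rightarrow> int"
  | Fibre 'k "('i \<Rightarrow> int) set"
  | Inner nat "'i \<Rightarrow> int"

text \<open>Every vertex \<open>a\<close> of the pattern is blown up to a fibre of residue vectors \<open>r\<close>, and an edge between
  different fibres gets the colour \<open>\<kappa> a b\<close> together with the affine forms
  \<open>\<alpha> i a b * r i + \<alpha> i b a * s i + \<sigma> i a b\<close>. Assumption \<open>conflict\<close> provides, for each alternating 4-cycle of the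
  pattern, a coordinate in which the two equations of a lifted alternating 4-cycle have proportional
  linear parts but incompatible constants. The distinguished coordinate \<open>z\<close>, whose modulus will
  tend to infinity, serves to colour the edges inside the fibres.\<close>

locale lifting = pattern K \<kappa>
  for K :: "'k set" and \<kappa> :: "'k \<Rightarrow> 'k \<Rightarrow> 't" +
  fixes I :: "'i set" and z :: 'i and N :: "'i \<Rightarrow> int"
    and \<alpha> :: "'i \<Rightarrow> 'k \<Rightarrow> 'k \<Rightarrow> int" and \<sigma> :: "'i \<Rightarrow> 'k \<Rightarrow> 'k \<Rightarrow> int"
  assumes finite_I: "finite I" and z: "z \<in> I"
    and N: "i \<in> I \<Longrightarrow> modulus_ok (N i)"
    and \<alpha>: "i \<in> I \<Longrightarrow> \<bar>\<alpha> i a b\<bar> \<in> {1, 2}"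
    and \<sigma>_sym: "\<sigma> i a b = \<sigma> i b a"
    and \<alpha>_cherry: "\<lbrakk>i \<in> I; a \<in> K; b \<in> K; c \<in> K; distinct [a, b, c]; \<kappa> a b = \<kappa> a c\<rbrakk>
      \<Longrightarrow> \<bar>\<alpha> i a b\<bar> \<noteq> \<bar>\<alpha> i a c\<bar>"
    and \<alpha>_z: "\<lbrakk>a \<in> K; b \<in> K; a \<noteq> b\<rbrakk> \<Longrightarrow> \<bar>\<alpha> z a b\<bar> \<noteq> \<bar>\<alpha> z b a\<bar>"
    and conflict: "\<lbrakk>a \<in> K; b \<in> K; c \<in> K; d \<in> K; distinct [a, b, c, d]; \<kappa> a b = \<kappa> c d; \<kappa> b c = \<kappa> d a\<rbrakk>
      \<Longrightarrow> \<exists>i\<in>I. \<alpha> i a b = - \<alpha> i a d \<and> \<alpha> i b a = \<alpha> i b c \<and> \<alpha> i c d = - \<alpha> i c b \<and> \<alpha> i d c = \<alpha> i d a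
            \<and> \<not> N i dvd \<sigma> i a b - \<sigma> i b c - \<sigma> i c d + \<sigma> i d a"
begin

definition V :: "('k \<times> ('i \<Rightarrow> int)) set" where
  "V = K \<times> (\<Pi>\<^sub>E i\<in>I. {0..<N i})"

definition lin :: "'i \<Rightarrow> 'k \<times> ('i \<Rightarrow> int) \<Rightarrow> 'k \<times> ('i \<Rightarrow> int) \<Rightarrow> int" where
  "lin i p q = \<alpha> i (fst p) (fst q) * snd p i + \<alpha> i (fst q) (fst p) * snd q i + \<sigma> i (fst p) (fst q)"

text \<open>Symmetric at \<open>z\<close>, so that congruences there hold whatever the directions;
  elsewhere the unequal coefficients tell the ends of a directed edge apart.\<close>

definition skew :: "'i \<Rightarrow> 'k \<times> ('i \<Rightarrow> int) \<Rightarrow> 'k \<times> ('i \<Rightarrow> int) \<Rightarrow> int" where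
  "skew i p q = snd p i + (if i = z then 1 else 2) * snd q i"

definition gap :: "'k \<times> ('i \<Rightarrow> int) \<Rightarrow> 'k \<times> ('i \<Rightarrow> int) \<Rightarrow> int" where
  "gap p q = (snd p z - snd q z) mod N z"

definition inner :: "'k \<times> ('i \<Rightarrow> int) \<Rightarrow> 'k \<times> ('i \<Rightarrow> int) \<Rightarrow> ('k, 't, 'i) colour" where
  "inner p q = Inner (doubling_label (N z) (gap p q)) (\<lambda>i\<in>I. skew i p q mod N i)"

text \<open>An edge whose ends differ at \<open>z\<close> is directed so that its gap is below
  \<open>N z / 2\<close>; exactly one direction qualifies because \<open>N z\<close> is odd.\<close>

definition C :: "'k \<times> ('i \<Rightarrow> int) \<Rightarrow> 'k \<times> ('i \<Rightarrow> int) \<Rightarrow> ('k, 't, 'i) colour" where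
  "C p q =
    (if fst p \<noteq> fst q then Cross (\<kappa> (fst p) (fst q)) (\<lambda>i\<in>I. lin i p q mod N i)
     else if snd p z = snd q z then Fibre (fst p) {(snd p)(z := 0), (snd q)(z := 0)}
     else if 2 * gap p q < N z then inner p q
     else inner q p)"

lemma V_eqI:
  assumes "p \<in> V" "q \<in> V" "fst p = fst q" "\<And>i. i \<in> I \<Longrightarrow> snd p i = snd q i"
  shows "p = q"
proof (rule prod_eqI)
  show "snd p = snd q"
    by (rule PiE_ext[where k = I and s = "\<lambda>i. {0..<N i}"]) (use assms in \<open>auto simp: V_def\<close>)
qed fact

lemma V_range: "p \<in> V \<Longrightarrow> i \<in> I \<Longrightarrow> snd p i \<in> {0..<N i}"
  and V_fst: "p \<in> V \<Longrightarrow> fst p \<in> K"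
  by (auto simp: V_def PiE_iff)

lemma gap_sum:
  assumes "p \<in> V" "q \<in> V" "snd p z \<noteq> snd q z"
  shows "gap p q + gap q p = N z" "0 < gap p q" "gap p q < N z" "gap p q \<noteq> gap q p"
proof -
  have r: "snd p z \<in> {0..<N z}" "snd q z \<in> {0..<N z}" using assms V_range z by auto
  have pos: "0 < N z" "odd (N z)" using N[OF z] by (auto simp: modulus_ok_def)
  consider "snd p z < snd q z" | "snd q z < snd p z" using assms by linarith
  then have "gap p q + gap q p = N z \<and> 0 < gap p q \<and> gap p q < N z"
  proof cases
    case 1
    then have "gap q p = snd q z - snd p z"
      unfolding gap_def using r by (intro mod_pos_pos_trivial) auto
    moreover have "gap p q = snd p z - snd q z + N z"
      unfolding gap_def using 1 r
      by (subst mod_add_self2[symmetric], intro mod_pos_pos_trivial) auto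
    ultimately show ?thesis using 1 r by auto
  next
    case 2
    then have "gap p q = snd p z - snd q z"
      unfolding gap_def using r by (intro mod_pos_pos_trivial) auto
    moreover have "gap q p = snd q z - snd p z + N z"
      unfolding gap_def using 2 r
      by (subst mod_add_self2[symmetric], intro mod_pos_pos_trivial) auto
    ultimately show ?thesis using 2 r by auto
  qed
  then show "gap p q + gap q p = N z" "0 < gap p q" "gap p q < N z" by auto
  with pos show "gap p q \<noteq> gap q p" by (metis even_add)
qed

lemma C_sym:
  assumes "p \<in> V" "q \<in> V"
  shows "C p q = C q p"
proof (cases "fst p = fst q \<and> snd p z \<noteq> snd q z")
  case True
  then have "2 * gap p q < N z \<longleftrightarrow> \<not> 2 * gap q p < N z"
    using gap_sum[OF assms] by auto
  then show ?thesis using True by (auto simp: C_def)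
next
  case False
  have "lin i p q = lin i q p" for i by (simp add: lin_def \<sigma>_sym)
  then show ?thesis using False by (auto simp: C_def insert_commute \<kappa>_sym)
qed

lemma C_crossD:
  assumes "fst p \<noteq> fst q" "C p q = C r s"
  shows "fst r \<noteq> fst s" "\<kappa> (fst p) (fst q) = \<kappa> (fst r) (fst s)"
    "i \<in> I \<Longrightarrow> N i dvd lin i p q - lin i r s"
proof -
  show *: "fst r \<noteq> fst s"
    using assms by (auto simp: C_def inner_def split: if_splits)
  show "\<kappa> (fst p) (fst q) = \<kappa> (fst r) (fst s)"
    using assms * by (simp add: C_def)
  assume i: "i \<in> I"
  have "(\<lambda>i\<in>I. lin i p q mod N i) = (\<lambda>i\<in>I. lin i r s mod N i)"
    using assms * by (simp add: C_def)
  from fun_cong[OF this, of i] i show "N i dvd lin i p q - lin i r s"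
    by (simp add: mod_eq_dvd_iff)
qed

lemma inner_eqD:
  assumes "inner p q = inner r s"
  shows "doubling_label (N z) (gap p q) = doubling_label (N z) (gap r s)"
    "i \<in> I \<Longrightarrow> N i dvd skew i p q - skew i r s"
proof -
  show "doubling_label (N z) (gap p q) = doubling_label (N z) (gap r s)"
    using assms by (simp add: inner_def)
  assume i: "i \<in> I"
  have "(\<lambda>i\<in>I. skew i p q mod N i) = (\<lambda>i\<in>I. skew i r s mod N i)"
    using assms by (simp add: inner_def)
  from fun_cong[OF this, of i] i show "N i dvd skew i p q - skew i r s"
    by (simp add: mod_eq_dvd_iff)
qed

lemma C_insideD:
  assumes "fst p = fst q" "C p q = C r s"
  shows "fst r = fst s" "snd p z = snd q z \<longleftrightarrow> snd r z = snd s z"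
  using assms by (auto simp: C_def inner_def split: if_splits)

lemma C_fibreD:
  assumes "fst p = fst q" "snd p z = snd q z" "C p q = C r s"
  shows "fst r = fst p" "{(snd p)(z := 0), (snd q)(z := 0)} = {(snd r)(z := 0), (snd s)(z := 0)}"
  using assms by (auto simp: C_def inner_def split: if_splits)

lemma C_inner:
  assumes "fst p = fst q" "snd p z \<noteq> snd q z" "p \<in> V" "q \<in> V"
  obtains "2 * gap p q < N z" "C p q = inner p q" | "2 * gap q p < N z" "C p q = inner q p"
  using assms gap_sum[of p q] that by (cases "2 * gap p q < N z") (auto simp: C_def)

lemma V_cancel:
  assumes "i \<in> I" "p \<in> V" "q \<in> V" "\<bar>k\<bar> \<in> {1, 2, 3, 4}" "N i dvd k * (snd p i - snd q i)"
  shows "snd p i = snd q i"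
  using modulus_ok_cancel[OF N assms(4,5)] assms V_range by blast

lemma V_cancel':
  assumes "N i dvd x" "x = k * (snd p i - snd q i)" "i \<in> I" "p \<in> V" "q \<in> V" "\<bar>k\<bar> \<in> {1, 2, 3, 4}"
  shows "snd p i = snd q i"
  using V_cancel assms by blast

lemma skew_z: "skew z p q = snd p z + snd q z"
  and skew_other: "i \<noteq> z \<Longrightarrow> skew i p q = snd p i + 2 * snd q i"
  by (simp_all add: skew_def)

lemma C_inner_sum:
  assumes "fst p = fst q" "snd p z \<noteq> snd q z" "p \<in> V" "q \<in> V" "r \<in> V" "s \<in> V" "C p q = C r s"
  shows "N z dvd (snd p z + snd q z) - (snd r z + snd s z)"
proof -
  have *: "fst r = fst s" "snd r z \<noteq> snd s z" using C_insideD[OF assms(1,7)] assms(2) by auto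
  have D: "N z dvd (snd w z + snd x z) - (snd y z + snd t z)" if "inner w x = inner y t" for w x y t
    using inner_eqD(2)[OF that z] by (simp add: skew_z)
  have "C p q = inner p q \<or> C p q = inner q p" "C r s = inner r s \<or> C r s = inner s r"
    using assms(1,2) * by (auto simp: C_def)
  then show ?thesis
    using D assms(7) by (metis add.commute)
qed

section \<open>Edges inside the fibres\<close>

text \<open>For \<open>Inner\<close> edges the sum at \<open>z\<close> determines the other end
  there, hence the direction; then \<open>skew\<close> determines the remaining coordinates.\<close>

lemma inside_proper:
  assumes V: "p \<in> V" "q \<in> V" "r \<in> V" and fst: "fst p = fst q" "fst p = fst r"
    and eq: "C p q = C p r"
  shows "q = r"
proof (cases "snd p z = snd q z")
  case True
  then have u: "snd p z = snd r z" using C_insideD(2)[OF fst(1) eq] by simp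
  have "(snd q)(z := 0) = (snd r)(z := 0)"
    using C_fibreD(2)[OF fst(1) True eq] by (auto simp: doubleton_eq_iff)
  then have "snd q i = snd r i" for i
    using True u by (cases "i = z") (auto simp: fun_eq_iff split: if_splits)
  then show ?thesis using V_eqI[of q r] V fst by auto
next
  case False
  have "N z dvd (snd p z + snd q z) - (snd p z + snd r z)"
    by (rule C_inner_sum) (use assms False in auto)
  then have u: "snd q z = snd r z"
    by (rule V_cancel'[where k = 1]) (use V z in auto)
  then have g: "gap p q = gap p r" "gap q p = gap r p" by (simp_all add: gap_def)
  have "snd q i = snd r i" if i: "i \<in> I" "i \<noteq> z" for i
  proof (cases "2 * gap p q < N z")
    case True
    then have "inner p q = inner p r" using eq fst False u g by (simp add: C_def)
    from inner_eqD(2)[OF this i(1)] show ?thesis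
      by (rule V_cancel'[where k = 2]) (use V i in \<open>auto simp: skew_other\<close>)
  next
    case *: False
    then have "inner q p = inner r p" using eq fst False u g by (simp add: C_def)
    from inner_eqD(2)[OF this i(1)] show ?thesis
      by (rule V_cancel'[where k = 1]) (use V i in \<open>auto simp: skew_other\<close>)
  qed
  then show ?thesis using V_eqI[of q r] V fst u by metis
qed

text \<open>Equally coloured \<open>Fibre\<close> edges have the same ends away from
  \<open>z\<close>. If all residues at \<open>z\<close> agree, two vertices coincide; otherwise the
  other two edges have equal gaps, so they are directed alike and comparing \<open>skew\<close>
  identifies \<open>a\<close> with \<open>b\<close>.\<close>

lemma inside_no_cycle_fibre:
  assumes V: "a \<in> V" "b \<in> V" "c \<in> V" "d \<in> V" and dist: "distinct [a, b, c, d]"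
    and fst: "fst a = fst b" "fst b = fst c" "fst c = fst d"
    and eq: "C a b = C c d" "C b c = C d a"
    and u: "snd a z = snd b z"
  shows False
proof -
  have u': "snd c z = snd d z" using C_insideD(2)[OF fst(1) eq(1)] u by simp
  have "{(snd a)(z := 0), (snd b)(z := 0)} = {(snd c)(z := 0), (snd d)(z := 0)}"
    using C_fibreD(2)[OF fst(1) u eq(1)] .
  then have cases: "(\<forall>i. i \<noteq> z \<longrightarrow> snd a i = snd c i \<and> snd b i = snd d i)
      \<or> (\<forall>i. i \<noteq> z \<longrightarrow> snd a i = snd d i \<and> snd b i = snd c i)"
    by (auto simp: doubleton_eq_iff fun_eq_iff split: if_splits)
  show False
  proof (cases "snd b z = snd c z")
    case True
    then have "a = c \<or> a = d"
      using cases u u' V_eqI[of a c] V_eqI[of a d] V fst by metis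
    then show False using dist by simp
  next
    case False
    have eq2: "C b c = C a d" using eq(2) C_sym V by simp
    have g: "gap b c = gap a d" "gap c b = gap d a" using u u' by (simp_all add: gap_def)
    have "snd a i = snd b i" if i: "i \<in> I" "i \<noteq> z" for i
    proof (cases "2 * gap b c < N z")
      case True
      then have "inner b c = inner a d" using eq2 fst False u u' g by (simp add: C_def)
      note D = inner_eqD(2)[OF this i(1)]
      show ?thesis using cases
      proof
        assume "\<forall>i. i \<noteq> z \<longrightarrow> snd a i = snd c i \<and> snd b i = snd d i"
        then show ?thesis
          using i V by (intro V_cancel'[OF D, where k = 1]) (auto simp: skew_other)
      next
        assume "\<forall>i. i \<noteq> z \<longrightarrow> snd a i = snd d i \<and> snd b i = snd c i"
        then show ?thesis
          using i V by (intro V_cancel'[OF D, where k = "-3"]) (auto simp: skew_other)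
      qed
    next
      case *: False
      then have "inner c b = inner d a" using eq2 fst False u u' g by (simp add: C_def)
      note D = inner_eqD(2)[OF this i(1)]
      show ?thesis using cases
      proof
        assume "\<forall>i. i \<noteq> z \<longrightarrow> snd a i = snd c i \<and> snd b i = snd d i"
        then show ?thesis
          using i V by (intro V_cancel'[OF D, where k = "-1"]) (auto simp: skew_other)
      next
        assume "\<forall>i. i \<noteq> z \<longrightarrow> snd a i = snd d i \<and> snd b i = snd c i"
        then show ?thesis
          using i V by (intro V_cancel'[OF D, where k = "-3"]) (auto simp: skew_other)
      qed
    qed
    then have "a = b" using V_eqI[of a b] V fst u by metis
    then show False using dist by simp
  qed
qed

text \<open>Adding and subtracting the congruences at \<open>z\<close> gives opposite vertices equal
  residues there. All edges are then directed from one opposite pair to the other, and the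
  \<open>skew\<close> congruences combine to 2 or 4 times \<open>a - c\<close>.\<close>

lemma inside_no_cycle:
  assumes V: "a \<in> V" "b \<in> V" "c \<in> V" "d \<in> V" and dist: "distinct [a, b, c, d]"
    and fst: "fst a = fst b" "fst b = fst c" "fst c = fst d"
    and eq: "C a b = C c d" "C b c = C d a"
  shows False
proof -
  have ab: "snd a z \<noteq> snd b z"
    using inside_no_cycle_fibre[OF V dist fst eq] by (rule notI)
  have "distinct [b, c, d, a]" "fst d = fst a" "C c d = C a b" using dist fst eq by auto
  then have bc: "snd b z \<noteq> snd c z"
    using inside_no_cycle_fibre[OF V(2-4) V(1)] fst eq(2) by metis
  have cd: "snd c z \<noteq> snd d z" using C_insideD(2)[OF fst(1) eq(1)] ab by simp
  have da: "snd d z \<noteq> snd a z" using C_insideD(2)[OF fst(2) eq(2)] bc by simp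
  have s1: "N z dvd (snd a z + snd b z) - (snd c z + snd d z)"
    by (rule C_inner_sum) (use assms ab in auto)
  have s2: "N z dvd (snd b z + snd c z) - (snd d z + snd a z)"
    by (rule C_inner_sum) (use assms bc in auto)
  have ac: "snd a z = snd c z"
    by (rule V_cancel'[OF dvd_diff[OF s1 s2], where k = 2]) (use V z in auto)
  have bd: "snd b z = snd d z"
    by (rule V_cancel'[OF dvd_add[OF s1 s2], where k = 2]) (use V z in auto)
  have g: "gap c d = gap a b" "gap b c = gap b a" "gap d a = gap b a" "gap c b = gap a b" "gap a d = gap a b"
    using ac bd by (simp_all add: gap_def)
  have or: "2 * gap a b < N z \<longleftrightarrow> \<not> 2 * gap b a < N z"
    using gap_sum[OF V(1,2) ab] by auto
  have "snd a i = snd c i" if i: "i \<in> I" "i \<noteq> z" for i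
  proof (cases "2 * gap a b < N z")
    case True
    then have "inner a b = inner c d" "inner c b = inner a d"
      using eq fst ab bc cd da g or by (simp_all add: C_def)
    note D = this[THEN inner_eqD(2), OF i(1)]
    show ?thesis
      by (rule V_cancel'[OF dvd_diff[OF D], where k = 2]) (use i V in \<open>auto simp: skew_other\<close>)
  next
    case False
    then have "inner b a = inner d c" "inner b c = inner d a"
      using eq fst ab bc cd da g or by (simp_all add: C_def)
    note D = this[THEN inner_eqD(2), OF i(1)]
    show ?thesis
      by (rule V_cancel'[OF dvd_diff[OF D], where k = 4]) (use i V in \<open>auto simp: skew_other\<close>)
  qed
  then have "a = c" using V_eqI[of a c] V fst ac by metis
  then show False using dist by simp
qed

lemma gap_cong: "\<exists>\<epsilon>\<in>{1, - 1}. N z dvd gap p q - \<epsilon> * (snd r z - snd s z)"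
  if "{p, q} = {r, s}"
proof -
  have "N z dvd gap p q - (snd p z - snd q z)"
    unfolding gap_def by (metis dvd_refl minus_mod_eq_mult_div dvd_triv_left dvd_minus_iff minus_diff_eq)
  moreover have "(p = r \<and> q = s) \<or> (p = s \<and> q = r)" using that by (auto simp: doubleton_eq_iff)
  ultimately show ?thesis by auto
qed

text \<open>At \<open>z\<close> the cross edges relate the differences along \<open>a b\<close> and
  \<open>c d\<close> with coefficients of absolute values 1 and 2, by \<open>\<alpha>_z\<close>. So
  one gap is twice the other up to sign, whereas equal \<open>Inner\<close> colours carry equal
  doubling labels.\<close>

lemma inside_no_cross_cycle:
  assumes V: "a \<in> V" "b \<in> V" "c \<in> V" "d \<in> V"
    and fst: "fst a = fst b" "fst c = fst d" "fst a \<noteq> fst c"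
    and eq: "C a b = C c d" "C b c = C d a"
  shows False
proof -
  have ab: "snd a z \<noteq> snd b z"
    using C_fibreD(1)[OF fst(1) _ eq(1)] fst(3) by auto
  then have cd: "snd c z \<noteq> snd d z" using C_insideD(2)[OF fst(1) eq(1)] by simp
  obtain p q where pq: "{p, q} = {b, a}" "2 * gap p q < N z" "C a b = inner p q" "0 < gap p q"
    using C_inner[OF fst(1) ab V(1,2)] gap_sum(2)[OF V(1,2) ab] gap_sum(2)[OF V(2,1) ab[symmetric]]
      insert_commute[of a b "{}"] by metis
  obtain r s where rs: "{r, s} = {c, d}" "2 * gap r s < N z" "C c d = inner r s" "0 < gap r s"
    using C_inner[OF fst(2) cd V(3,4)] gap_sum(2)[OF V(3,4) cd] gap_sum(2)[OF V(4,3) cd[symmetric]]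
      insert_commute[of c d "{}"] by metis
  have label: "doubling_label (N z) (gap p q) = doubling_label (N z) (gap r s)"
    using inner_eqD(1) pq rs eq by metis
  obtain \<epsilon> where \<epsilon>: "\<epsilon> = 1 \<or> \<epsilon> = -1" "N z dvd gap p q - \<epsilon> * (snd b z - snd a z)"
    using gap_cong[OF pq(1)] by blast
  obtain \<eta> where \<eta>: "\<eta> = 1 \<or> \<eta> = -1" "N z dvd gap r s - \<eta> * (snd c z - snd d z)"
    using gap_cong[OF rs(1)] by blast
  define \<beta> \<gamma> where "\<beta> = \<alpha> z (fst a) (fst c)" and "\<gamma> = \<alpha> z (fst c) (fst a)"
  have \<beta>\<gamma>: "\<bar>\<beta>\<bar> = 1 \<and> \<bar>\<gamma>\<bar> = 2 \<or> \<bar>\<beta>\<bar> = 2 \<and> \<bar>\<gamma>\<bar> = 1"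
    unfolding \<beta>_def \<gamma>_def using \<alpha>[OF z, of "fst a" "fst c"] \<alpha>[OF z, of "fst c" "fst a"] \<alpha>_z[of "fst a" "fst c"] V_fst V fst(3)
    by auto
  have "N z dvd lin z b c - lin z d a"
    by (rule C_crossD(3)) (use fst eq z in auto)
  also have "lin z b c - lin z d a = \<beta> * (snd b z - snd a z) + \<gamma> * (snd c z - snd d z)"
    using fst \<sigma>_sym[of z "fst a" "fst c"] by (simp add: lin_def \<beta>_def \<gamma>_def algebra_simps)
  finally have L: "N z dvd \<beta> * (snd b z - snd a z) + \<gamma> * (snd c z - snd d z)" .
  have "N z dvd (\<beta> * (snd b z - snd a z) + \<gamma> * (snd c z - snd d z))
      + (\<beta> * \<epsilon>) * (gap p q - \<epsilon> * (snd b z - snd a z)) + (\<gamma> * \<eta>) * (gap r s - \<eta> * (snd c z - snd d z))"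
    by (rule dvd_add[OF dvd_add[OF L dvd_mult[OF \<epsilon>(2)]] dvd_mult[OF \<eta>(2)]])
  also have "(\<beta> * (snd b z - snd a z) + \<gamma> * (snd c z - snd d z))
      + \<beta> * \<epsilon> * (gap p q - \<epsilon> * (snd b z - snd a z)) + \<gamma> * \<eta> * (gap r s - \<eta> * (snd c z - snd d z))
      = \<beta> * \<epsilon> * gap p q + \<gamma> * \<eta> * gap r s"
    using \<epsilon>(1) \<eta>(1) by (auto simp: algebra_simps)
  finally have D: "N z dvd \<beta> * \<epsilon> * gap p q + \<gamma> * \<eta> * gap r s" .
  define k l where "k = \<beta> * \<epsilon>" and "l = \<gamma> * \<eta>"
  have "k \<in> {1, -1} \<and> l \<in> {2, -2} \<or> k \<in> {2, -2} \<and> l \<in> {1, -1}"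
    using \<beta>\<gamma> \<epsilon>(1) \<eta>(1) by (auto simp: k_def l_def abs_if split: if_splits)
  moreover have "N z dvd k * gap p q + l * gap r s" "N z dvd - (k * gap p q + l * gap r s)"
    using D by (simp_all only: k_def l_def dvd_minus_iff)
  ultimately have "(N z dvd 2 * gap p q - gap r s \<or> N z dvd 2 * gap p q + gap r s)
      \<or> (N z dvd 2 * gap r s - gap p q \<or> N z dvd 2 * gap r s + gap p q)"
    by (auto simp: algebra_simps)
  then show False
    using doubling_label_neq[OF N[OF z], of "gap p q" "gap r s"]
      doubling_label_neq[OF N[OF z], of "gap r s" "gap p q"] pq rs label by auto
qed

section \<open>Cherries and alternating cycles across fibres\<close>

text \<open>The colouring is proper inside a fibre, and two ends in one fibre are separated by an
  invertible coefficient; hence every cherry lies over a cherry of the pattern.\<close>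

lemma C_cherry:
  assumes V: "p \<in> V" "q \<in> V" "r \<in> V" and dist: "distinct [p, q, r]" and eq: "C p q = C p r"
  shows "distinct [fst p, fst q, fst r]" "\<kappa> (fst p) (fst q) = \<kappa> (fst p) (fst r)"
proof -
  have pq: "fst p \<noteq> fst q"
  proof
    assume *: "fst p = fst q"
    then have "fst p = fst r" using C_insideD(1)[OF * eq] by simp
    then show False using inside_proper[OF V * _ eq] dist by simp
  qed
  note D = C_crossD[OF pq eq]
  have "fst q \<noteq> fst r"
  proof
    assume *: "fst q = fst r"
    have "snd q i = snd r i" if i: "i \<in> I" for i
      by (rule V_cancel'[OF D(3)[OF i], where k = "\<alpha> i (fst q) (fst p)"])
        (use * V i \<alpha>[OF i] in \<open>auto simp: lin_def algebra_simps\<close>)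
    then show False using V_eqI[of q r] V * dist by auto
  qed
  then show "distinct [fst p, fst q, fst r]" "\<kappa> (fst p) (fst q) = \<kappa> (fst p) (fst r)"
    using pq D by auto
qed

lemma \<alpha>_sum:
  assumes "i \<in> I" "a \<in> K" "b \<in> K" "c \<in> K" "distinct [a, b, c]" "\<kappa> a b = \<kappa> a c"
  shows "\<bar>\<alpha> i a b + \<alpha> i a c\<bar> \<in> {1, 2, 3, 4}" "\<bar>\<alpha> i a b - \<alpha> i a c\<bar> \<in> {1, 2, 3, 4}"
  using \<alpha>_cherry[OF assms] \<alpha>[OF assms(1), of a b] \<alpha>[OF assms(1), of a c] by auto

text \<open>The four forms combine so that \<open>b\<close>, \<open>c\<close> and the constants
  cancel, leaving \<open>a - d\<close> times a difference of coefficients of absolute values 1 and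
  2.\<close>

lemma same_fibre_cherries:
  assumes V: "a \<in> V" "b \<in> V" "c \<in> V" "d \<in> V" and dist: "distinct [a, b, c]"
    and fst: "fst d = fst a" and eq: "C a b = C a c" "C d b = C d c"
  shows "a = d"
proof -
  note ch = C_cherry[OF V(1-3) dist eq(1)]
  have "snd a i = snd d i" if i: "i \<in> I" for i
  proof (rule V_cancel'[where k = "\<alpha> i (fst a) (fst b) - \<alpha> i (fst a) (fst c)"])
    show "N i dvd (lin i a b - lin i a c) - (lin i d b - lin i d c)"
      by (intro dvd_diff C_crossD(3)[OF _ _ i]) (use ch fst eq in auto)
    show "(lin i a b - lin i a c) - (lin i d b - lin i d c)
      = (\<alpha> i (fst a) (fst b) - \<alpha> i (fst a) (fst c)) * (snd a i - snd d i)"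
      using fst by (simp add: lin_def algebra_simps)
  qed (use V i \<alpha>_sum(2)[OF i V_fst V_fst V_fst ch] in auto)
  then show ?thesis by (intro V_eqI[OF V(1,4) fst[symmetric]])
qed

text \<open>A further coincidence descends to the pattern, where \<open>star\<close> excludes it if
  the four fibres differ, and \<open>triangle\<close> or \<open>C_cherry\<close> otherwise. The
  exception is \<open>C b d = C c d\<close> with \<open>d\<close> in the fibre of \<open>a\<close>,
  settled by \<open>same_fibre_cherries\<close>.\<close>

lemma C_star:
  assumes V: "a \<in> V" "b \<in> V" "c \<in> V" "d \<in> V" and dist: "distinct [a, b, c, d]"
    and eq: "C a b = C a c"
  shows "distinct [C a b, C b c, C a d, C b d, C c d]"
proof -
  let ?A = "fst a" and ?B = "fst b" and ?C = "fst c" and ?D = "fst d"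
  have K: "?A \<in> K" "?B \<in> K" "?C \<in> K" "?D \<in> K" using V V_fst by auto
  have abc: "distinct [?A, ?B, ?C]" "\<kappa> ?A ?B = \<kappa> ?A ?C"
    using C_cherry[of a b c] V dist eq by auto
  have tri: "\<kappa> ?B ?C \<noteq> \<kappa> ?A ?B" using triangle K abc by blast
  have st: "distinct [\<kappa> ?A ?B, \<kappa> ?B ?C, \<kappa> ?A ?D, \<kappa> ?B ?D, \<kappa> ?C ?D]" if "?D \<notin> {?A, ?B, ?C}"
    using star[of ?A ?B ?C ?D] K abc that by auto
  have ch: "distinct [fst p, fst q, fst r] \<and> \<kappa> (fst p) (fst q) = \<kappa> (fst p) (fst r)"
    if "C p q = C p r" "{p, q, r} \<subseteq> {a, b, c, d}" "distinct [p, q, r]" for p q r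
    using C_cherry[of p q r] V that by auto
  have 1: "C a b \<noteq> C b c"
  proof
    assume "C a b = C b c"
    then have "C b a = C b c" using C_sym V by simp
    then have "distinct [fst b, fst a, fst c]" "\<kappa> (fst b) (fst a) = \<kappa> (fst b) (fst c)"
      using ch[of b a c] dist by auto
    then show False using tri \<kappa>_sym[of ?A ?B] by simp
  qed
  have 2: "C a b \<noteq> C a d"
  proof
    assume "C a b = C a d"
    then have "distinct [?A, ?B, ?D] \<and> \<kappa> ?A ?B = \<kappa> ?A ?D" "distinct [?A, ?C, ?D]"
      using ch[of a b d] ch[of a c d] eq dist by auto
    then show False using st by auto
  qed
  have 3: "C a b \<noteq> C b d"
  proof
    assume "C a b = C b d"
    then have "C b a = C b d" using C_sym V by simp
    then have "distinct [fst b, fst a, fst d]" "\<kappa> (fst b) (fst a) = \<kappa> (fst b) (fst d)"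
      using ch[of b a d] dist by auto
    then show False using st abc tri \<kappa>_sym[of ?A ?B]
      by (cases "?D = ?C") auto
  qed
  have 4: "C a c \<noteq> C c d"
  proof
    assume "C a c = C c d"
    then have "C c a = C c d" using C_sym V by simp
    then have "distinct [fst c, fst a, fst d]" "\<kappa> (fst c) (fst a) = \<kappa> (fst c) (fst d)"
      using ch[of c a d] dist by auto
    then show False using st abc tri \<kappa>_sym[of ?A ?C] \<kappa>_sym[of ?B ?C]
      by (cases "?D = ?B") auto
  qed
  have 5: "C b c \<noteq> C a d"
  proof
    assume *: "C b c = C a d"
    have "?A \<noteq> ?D" "\<kappa> ?B ?C = \<kappa> ?A ?D" using C_crossD(1,2)[OF _ *] abc by auto
    then show False using st abc tri by (cases "?D = ?B \<or> ?D = ?C") auto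
  qed
  have 6: "C b c \<noteq> C b d"
  proof
    assume "C b c = C b d"
    then have "C b c = C b d" using C_sym V by simp
    then have "distinct [fst b, fst c, fst d]" "\<kappa> (fst b) (fst c) = \<kappa> (fst b) (fst d)"
      using ch[of b c d] dist by auto
    then show False using st abc tri \<kappa>_sym[of ?A ?B]
      by (cases "?D = ?A") auto
  qed
  have 7: "C b c \<noteq> C c d"
  proof
    assume "C b c = C c d"
    then have "C c b = C c d" using C_sym V by simp
    then have "distinct [fst c, fst b, fst d]" "\<kappa> (fst c) (fst b) = \<kappa> (fst c) (fst d)"
      using ch[of c b d] dist by auto
    then show False using st abc tri \<kappa>_sym[of ?A ?C] \<kappa>_sym[of ?B ?C]
      by (cases "?D = ?A") auto
  qed
  have 8: "C a d \<noteq> C b d"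
  proof
    assume "C a d = C b d"
    then have "C d a = C d b" using C_sym V by simp
    then have "distinct [fst d, fst a, fst b]" "\<kappa> (fst d) (fst a) = \<kappa> (fst d) (fst b)"
      using ch[of d a b] dist by auto
    then show False using st abc tri \<kappa>_sym[of ?A ?D] \<kappa>_sym[of ?B ?D] \<kappa>_sym[of ?A ?C] \<kappa>_sym[of ?B ?C]
      by (cases "?D = ?C") auto
  qed
  have 9: "C a d \<noteq> C c d"
  proof
    assume "C a d = C c d"
    then have "C d a = C d c" using C_sym V by simp
    then have "distinct [fst d, fst a, fst c]" "\<kappa> (fst d) (fst a) = \<kappa> (fst d) (fst c)"
      using ch[of d a c] dist by auto
    then show False using st abc tri \<kappa>_sym[of ?A ?D] \<kappa>_sym[of ?C ?D] \<kappa>_sym[of ?A ?B] \<kappa>_sym[of ?B ?C]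
      by (cases "?D = ?B") auto
  qed
  have 10: "C b d \<noteq> C c d"
  proof
    assume *: "C b d = C c d"
    then have db: "C d b = C d c" using C_sym V by simp
    then have "distinct [?D, ?B, ?C]" "\<kappa> ?D ?B = \<kappa> ?D ?C" using ch[of d b c] dist by auto
    then have "?D = ?A" using st \<kappa>_sym[of ?B ?D] \<kappa>_sym[of ?C ?D] by auto
    moreover note db
    ultimately show False using same_fibre_cherries[of a b c d] V dist eq by auto
  qed
  show ?thesis using 1 2 3 4[folded eq] 5 6 7 8 9 10 by simp
qed

text \<open>The forms combine to \<open>a - c\<close> times a sum of two coefficients. They are
  equal if \<open>b\<close> and \<open>d\<close> share a fibre and otherwise have absolute values 1
  and 2, so the sum is invertible.\<close>

lemma cross_cycle_same_fibre:
  assumes V: "a \<in> V" "b \<in> V" "c \<in> V" "d \<in> V" and dist: "distinct [a, b, c, d]"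
    and fst: "fst a \<noteq> fst b" "fst a \<noteq> fst d" "fst c = fst a"
    and eq: "C a b = C c d" "C b c = C d a"
  shows False
proof -
  let ?A = "fst a" and ?B = "fst b" and ?D = "fst d"
  have K: "?A \<in> K" "?B \<in> K" "?D \<in> K" using V V_fst by auto
  have \<kappa>: "\<kappa> ?A ?B = \<kappa> ?A ?D" using C_crossD(2)[OF fst(1) eq(1)] fst by simp
  have k: "\<bar>\<alpha> i ?A ?B + \<alpha> i ?A ?D\<bar> \<in> {1, 2, 3, 4}" if i: "i \<in> I" for i
  proof (cases "?B = ?D")
    case True
    then show ?thesis using \<alpha>[OF i, of ?A ?B] by auto
  next
    case False
    then show ?thesis using \<alpha>_sum(1)[OF i K _ \<kappa>] fst by auto
  qed
  have "snd a i = snd c i" if i: "i \<in> I" for i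
  proof (rule V_cancel'[where k = "\<alpha> i ?A ?B + \<alpha> i ?A ?D"])
    show "N i dvd (lin i a b - lin i c d) - (lin i b c - lin i d a)"
      by (intro dvd_diff C_crossD(3)[OF _ _ i]) (use fst eq in auto)
    show "(lin i a b - lin i c d) - (lin i b c - lin i d a)
      = (\<alpha> i ?A ?B + \<alpha> i ?A ?D) * (snd a i - snd c i)"
      using fst \<sigma>_sym[of i ?A] by (simp add: lin_def algebra_simps)
  qed (use V i k in auto)
  then have "a = c" by (intro V_eqI[OF V(1,3) fst(3)[symmetric]])
  then show False using dist by simp
qed

text \<open>The cycle lies in one fibre, has two opposite edges inside two fibres, has two opposite
  vertices in one fibre with only cross edges, or lies over an alternating 4-cycle of the pattern;
  the last case is what \<open>conflict\<close> is for.\<close>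

lemma C_no_cycle:
  assumes V: "a \<in> V" "b \<in> V" "c \<in> V" "d \<in> V" and dist: "distinct [a, b, c, d]"
    and eq: "C a b = C c d" "C b c = C d a"
  shows False
proof -
  let ?A = "fst a" and ?B = "fst b" and ?C = "fst c" and ?D = "fst d"
  have K: "?A \<in> K" "?B \<in> K" "?C \<in> K" "?D \<in> K" using V V_fst by auto
  have dist': "distinct [b, c, d, a]" using dist by auto
  have i1: "?A = ?B \<longleftrightarrow> ?C = ?D"
    using C_insideD(1)[OF _ eq(1)] C_insideD(1)[OF _ eq(1)[symmetric]] by blast
  have i2: "?B = ?C \<longleftrightarrow> ?D = ?A"
    using C_insideD(1)[OF _ eq(2)] C_insideD(1)[OF _ eq(2)[symmetric]] by blast
  show False
  proof (cases "?A = ?B \<or> ?B = ?C")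
    case True
    then show False
    proof (cases "?A = ?C")
      case True
      then have "?A = ?B" "?B = ?C" "?C = ?D" using \<open>?A = ?B \<or> ?B = ?C\<close> i1 i2 by metis+
      then show False by (rule inside_no_cycle[OF V dist _ _ _ eq])
    next
      case False
      from \<open>?A = ?B \<or> ?B = ?C\<close> show False
      proof
        assume "?A = ?B"
        moreover from this have "?C = ?D" using i1 by simp
        ultimately show False using False by (rule inside_no_cross_cycle[OF V _ _ _ eq])
      next
        assume "?B = ?C"
        moreover from this have "?D = ?A" using i2 by simp
        moreover from calculation have "?B \<noteq> ?D" using False by simp
        ultimately show False by (rule inside_no_cross_cycle[OF V(2-4) V(1) _ _ _ eq(2) eq(1)[symmetric]])
      qed
    qed
  next
    case cross: False
    have "?A = ?C \<or> ?B = ?D \<or> distinct [?A, ?B, ?C, ?D]"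
      using cross i1 i2 by auto
    then consider "?A = ?C" | "?B = ?D" | "distinct [?A, ?B, ?C, ?D]" by blast
    then show False
    proof cases
      case 1
      then have "?A \<noteq> ?B" "?A \<noteq> ?D" "?C = ?A" using cross i2 by metis+
      then show False by (rule cross_cycle_same_fibre[OF V dist _ _ _ eq])
    next
      case 2
      then have "?B \<noteq> ?C" "?B \<noteq> ?A" "?D = ?B" using cross by metis+
      then show False by (rule cross_cycle_same_fibre[OF V(2-4) V(1) dist' _ _ _ eq(2) eq(1)[symmetric]])
    next
      case 3
      have "\<kappa> ?A ?B = \<kappa> ?C ?D" "\<kappa> ?B ?C = \<kappa> ?D ?A"
        using C_crossD(2)[OF _ eq(1)] C_crossD(2)[OF _ eq(2)] 3 by auto
      then obtain i where i: "i \<in> I" "\<alpha> i ?A ?B = - \<alpha> i ?A ?D" "\<alpha> i ?B ?A = \<alpha> i ?B ?C"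
          "\<alpha> i ?C ?D = - \<alpha> i ?C ?B" "\<alpha> i ?D ?C = \<alpha> i ?D ?A"
          "\<not> N i dvd \<sigma> i ?A ?B - \<sigma> i ?B ?C - \<sigma> i ?C ?D + \<sigma> i ?D ?A"
        using conflict[OF K 3] by blast
      have "N i dvd (lin i a b - lin i c d) - (lin i b c - lin i d a)"
        by (intro dvd_diff C_crossD(3)[OF _ _ i(1)]) (use 3 eq in auto)
      also have "\<dots> = \<sigma> i ?A ?B - \<sigma> i ?B ?C - \<sigma> i ?C ?D + \<sigma> i ?D ?A"
        using i by (simp add: lin_def algebra_simps)
      finally show False using i(6) by simp
    qed
  qed
qed

lemma at_most_one_repetition_C: "at_most_one_repetition V C"
  unfolding at_most_one_repetition_def
proof (intro ballI impI conjI notI)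
  fix a b c d
  assume V: "a \<in> V" "b \<in> V" "c \<in> V" "d \<in> V" and dist: "distinct [a, b, c, d]"
  show "distinct [C a b, C b c, C a d, C b d, C c d]" if "C a b = C a c"
    using C_star[OF V dist that] .
  show False if "C a b = C c d \<and> C b c = C d a"
    using C_no_cycle[OF V dist] that by simp
qed

section \<open>Counting the colours of the lift\<close>

lemma card_V: "card V = card K * (\<Prod>i\<in>I. nat (N i))" and finite_V: "finite V"
proof -
  show "card V = card K * (\<Prod>i\<in>I. nat (N i))"
    by (simp add: V_def card_cartesian_product card_PiE finite_I)
  show "finite V"
    unfolding V_def using finite_K finite_I by (intro finite_cartesian_product finite_PiE) auto
qed

text \<open>The 4 counts the doubling labels of \<open>Inner\<close>. The \<open>Fibre\<close>
  colours are bounded by all subsets instead of pairs, which is crude but free of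
  \<open>N z\<close>.\<close>

lemma erdos_gyarfas_lifting_le:
  assumes n: "n \<le> card K * (\<Prod>i\<in>I. nat (N i))"
    and \<kappa>: "\<And>a b. a \<in> K \<Longrightarrow> b \<in> K \<Longrightarrow> a \<noteq> b \<Longrightarrow> \<kappa> a b \<in> T" "finite T"
  shows "erdos_gyarfas n 4 5 \<le>
    (card T + 4) * (\<Prod>i\<in>I. nat (N i)) + card K * 2 ^ (\<Prod>i\<in>I - {z}. nat (N i))"
proof -
  define X where "X = (\<Pi>\<^sub>E i\<in>I. {0..<N i})"
  \<comment> \<open>The range \<open>{0..<1}\<close> pins coordinate \<open>z\<close> to 0, the
    value written by \<open>C\<close>.\<close>
  define Y where "Y = (\<Pi>\<^sub>E i\<in>I. {0..<(if i = z then 1 else N i)})"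
  define \<Gamma> where "\<Gamma> = case_prod Cross ` (T \<times> X) \<union> case_prod Inner ` ({..3} \<times> X) \<union> case_prod Fibre ` (K \<times> Pow Y)"
  have N0: "0 < N i" if "i \<in> I" for i using N[OF that] by (simp add: modulus_ok_def)
  have finX: "finite X" "finite Y" by (simp_all add: X_def Y_def finite_I finite_PiE)
  have cX: "card X = (\<Prod>i\<in>I. nat (N i))"
    by (simp add: X_def card_PiE finite_I)
  have cY: "card Y = (\<Prod>i\<in>I - {z}. nat (N i))"
  proof -
    have "card Y = (\<Prod>i\<in>I. nat (if i = z then 1 else N i))"
      by (simp add: Y_def card_PiE finite_I)
    also have "\<dots> = (\<Prod>i\<in>I - {z}. nat (if i = z then 1 else N i))"
      using z finite_I by (subst prod.remove[of I z]) auto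
    also have "\<dots> = (\<Prod>i\<in>I - {z}. nat (N i))" by (rule prod.cong) auto
    finally show ?thesis .
  qed
  have "C p q \<in> \<Gamma>" if pq: "p \<in> V" "q \<in> V" "p \<noteq> q" for p q
  proof -
    have res: "(\<lambda>i\<in>I. f i mod N i) \<in> X" for f
      using N0 by (auto simp: X_def)
    have inn: "inner p q \<in> \<Gamma>" for p q
      unfolding inner_def \<Gamma>_def using res doubling_label_le
      by (intro UnI1 UnI2 image_eqI[where x = "(doubling_label (N z) (gap p q), \<lambda>i\<in>I. skew i p q mod N i)"]) auto
    have upd: "(snd p)(z := 0) \<in> Y" if "p \<in> V" for p
      using V_range[OF that] that z unfolding Y_def V_def by (auto simp: PiE_iff extensional_def)
    have crs: "Cross (\<kappa> (fst p) (fst q)) (\<lambda>i\<in>I. lin i p q mod N i) \<in> \<Gamma>" if "fst p \<noteq> fst q"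
      unfolding \<Gamma>_def using res \<kappa>(1) V_fst pq that
      by (intro UnI1 image_eqI[where x = "(\<kappa> (fst p) (fst q), \<lambda>i\<in>I. lin i p q mod N i)"]) auto
    have fib: "Fibre (fst p) {(snd p)(z := 0), (snd q)(z := 0)} \<in> \<Gamma>"
      unfolding \<Gamma>_def using upd V_fst pq
      by (intro UnI2 image_eqI[where x = "(fst p, {(snd p)(z := 0), (snd q)(z := 0)})"]) auto
    show ?thesis unfolding C_def using inn crs fib by (simp only: split: if_split) blast
  qed
  then have "erdos_gyarfas n 4 5 \<le> card \<Gamma>"
    by (intro erdos_gyarfas_le[where V = V and C = C])
      (use C_sym finite_V card_V n at_most_one_repetition_C finX \<kappa>(2) finite_K in \<open>auto simp: \<Gamma>_def\<close>)
  also have "card \<Gamma> \<le> card (T \<times> X) + card ({..3::nat} \<times> X) + card (K \<times> Pow Y)"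
    unfolding \<Gamma>_def using finX \<kappa>(2) finite_K
    by (intro order.trans[OF card_Un_le] add_mono card_image_le) auto
  also have "\<dots> = (card T + 4) * (\<Prod>i\<in>I. nat (N i)) + card K * 2 ^ (\<Prod>i\<in>I - {z}. nat (N i))"
    using cX cY finX by (simp add: card_cartesian_product card_Pow algebra_simps)
  finally show ?thesis .
qed

end

section \<open>Coefficients from an orientation of the pattern\<close>

text \<open>\<open>g\<close> gives the coefficients at \<open>z\<close> and the default ones at the
  coordinates of the alternating cycles.\<close>

locale oriented_pattern = pattern K \<kappa>
  for K :: "'k set" and \<kappa> :: "'k \<Rightarrow> 'k \<Rightarrow> 't" +
  fixes g :: "'k \<Rightarrow> 'k \<Rightarrow> int"
  assumes g: "g a b \<in> {1, 2}"
    and g_antisym: "\<lbrakk>a \<in> K; b \<in> K; a \<noteq> b\<rbrakk> \<Longrightarrow> g a b \<noteq> g b a"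
    and g_cherry: "\<lbrakk>a \<in> K; b \<in> K; c \<in> K; distinct [a, b, c]; \<kappa> a b = \<kappa> a c\<rbrakk> \<Longrightarrow> g a b \<noteq> g a c"
begin

definition cycles :: "('k \<times> 'k \<times> 'k \<times> 'k) set" where
  "cycles = {(a, b, c, d). {a, b, c, d} \<subseteq> K \<and> distinct [a, b, c, d] \<and> \<kappa> a b = \<kappa> c d \<and> \<kappa> b c = \<kappa> d a}"

definition sides :: "'k \<times> 'k \<times> 'k \<times> 'k \<Rightarrow> ('k \<times> 'k) set" where
  "sides = (\<lambda>(a, b, c, d). {(a, b), (b, a), (b, c), (c, b), (c, d), (d, c), (d, a), (a, d)})"

text \<open>The sides of the cycle that is to be destroyed need coefficients \<open>\<plusminus>1\<close>. A cherry has at most one leg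
  among these sides, so its other leg can be given the coefficient 2.\<close>

definition weight :: "'k \<times> 'k \<times> 'k \<times> 'k \<Rightarrow> 'k \<Rightarrow> 'k \<Rightarrow> int" where
  "weight m x y =
    (if (x, y) \<in> sides m then 1
     else if \<exists>y'. distinct [x, y, y'] \<and> \<kappa> x y = \<kappa> x y' \<and> (x, y') \<in> sides m then 2
     else g x y)"

definition coeff :: "'k \<times> 'k \<times> 'k \<times> 'k \<Rightarrow> 'k \<Rightarrow> 'k \<Rightarrow> int" where
  "coeff = (\<lambda>(a, b, c, d) x y. (if (x, y) \<in> {(a, d), (c, b)} then - 1 else 1) * weight (a, b, c, d) x y)"

text \<open>Shifting one side only makes the combination of constants in \<open>conflict\<close>
  equal to 1.\<close>

definition shift :: "'k \<times> 'k \<times> 'k \<times> 'k \<Rightarrow> 'k \<Rightarrow> 'k \<Rightarrow> int" where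
  "shift = (\<lambda>(a, b, c, d) x y. if {x, y} = {a, b} then 1 else 0)"

lemma abs_coeff: "\<bar>coeff m x y\<bar> = weight m x y" and weight: "weight m x y \<in> {1, 2}"
proof -
  show "weight m x y \<in> {1, 2}" using g[of x y] by (auto simp: weight_def)
  then show "\<bar>coeff m x y\<bar> = weight m x y" by (auto simp: coeff_def split: prod.splits)
qed

lemma sides_in_K: "m \<in> cycles \<Longrightarrow> (x, y) \<in> sides m \<Longrightarrow> x \<in> K \<and> y \<in> K"
  by (auto simp: cycles_def sides_def)

text \<open>By \<open>star\<close> a cherry excludes any further coincidence, but the side opposite
  to a leg repeats its colour.\<close>

lemma cycle_no_cherry:
  assumes "m \<in> cycles" "y \<noteq> y'" "(x, y) \<in> sides m" "(x, y') \<in> sides m"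
  shows "\<kappa> x y \<noteq> \<kappa> x y'"
proof
  assume eq: "\<kappa> x y = \<kappa> x y'"
  obtain a b c d where m: "m = (a, b, c, d)" by (cases m)
  have abcd: "a \<in> K" "b \<in> K" "c \<in> K" "d \<in> K" "distinct [a, b, c, d]" "\<kappa> a b = \<kappa> c d" "\<kappa> b c = \<kappa> d a"
    using assms(1) by (auto simp: m cycles_def)
  have 1: "\<kappa> a b \<noteq> \<kappa> a d" using star[of a b d c] \<kappa>_sym[of c d] abcd by auto
  have 2: "\<kappa> b a \<noteq> \<kappa> b c" using star[of b a c d] \<kappa>_sym[of b a] abcd by auto
  have 3: "\<kappa> c b \<noteq> \<kappa> c d" using star[of c b d a] \<kappa>_sym[of b c] abcd by auto
  have 4: "\<kappa> d c \<noteq> \<kappa> d a" using star[of d c a b] \<kappa>_sym[of c d] abcd by auto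
  show False
    using assms(2-4) abcd(5) eq 1 2 3 4 by (auto simp: m sides_def)
qed

text \<open>By \<open>star\<close> no three edges of one colour meet at a vertex, so the witness
  \<open>y'\<close> in \<open>weight\<close> can only be the other leg.\<close>

lemma weight_cherry:
  assumes m: "m \<in> cycles" and K: "a \<in> K" "b \<in> K" "c \<in> K"
    and dist: "distinct [a, b, c]" and eq: "\<kappa> a b = \<kappa> a c"
  shows "weight m a b \<noteq> weight m a c"
proof -
  have third: "y = c" if "distinct [a, b, y]" "\<kappa> a b = \<kappa> a y" "(a, y) \<in> sides m" for y
    using that star[of a b c y] sides_in_K[OF m] dist K eq by fastforce
  have third': "y = b" if "distinct [a, c, y]" "\<kappa> a c = \<kappa> a y" "(a, y) \<in> sides m" for y
    using that star[of a b c y] sides_in_K[OF m] dist K eq by fastforce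
  consider "(a, b) \<in> sides m" "(a, c) \<notin> sides m" | "(a, b) \<notin> sides m" "(a, c) \<in> sides m"
    | "(a, b) \<notin> sides m" "(a, c) \<notin> sides m"
    using cycle_no_cherry[OF m, of b c a] dist eq by auto
  then show ?thesis
  proof cases
    case 1
    then have "\<exists>y'. distinct [a, c, y'] \<and> \<kappa> a c = \<kappa> a y' \<and> (a, y') \<in> sides m"
      using dist eq by (intro exI[of _ b]) auto
    then show ?thesis using 1 by (simp add: weight_def)
  next
    case 2
    then have "\<exists>y'. distinct [a, b, y'] \<and> \<kappa> a b = \<kappa> a y' \<and> (a, y') \<in> sides m"
      using dist eq by (intro exI[of _ c]) auto
    then show ?thesis using 2 by (simp add: weight_def)
  next
    case 3
    have "\<not> (\<exists>y'. distinct [a, b, y'] \<and> \<kappa> a b = \<kappa> a y' \<and> (a, y') \<in> sides m)"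
      using third 3 by blast
    moreover have "\<not> (\<exists>y'. distinct [a, c, y'] \<and> \<kappa> a c = \<kappa> a y' \<and> (a, y') \<in> sides m)"
      using third' 3 by blast
    ultimately show ?thesis
      using 3 g_cherry[OF K dist eq] unfolding weight_def by (simp only: if_False simp_thms)
  qed
qed

lemma finite_cycles: "finite cycles"
  by (rule finite_subset[of _ "K \<times> K \<times> K \<times> K"]) (auto simp: cycles_def finite_K)

text \<open>\<open>None\<close> stands for \<open>z\<close> with the free modulus \<open>Q\<close>.
  Each alternating cycle gets its own coordinate modulo 5, the least modulus above 1 that is coprime
  to 6.\<close>

lemma lifting:
  assumes Q: "modulus_ok Q"
  shows "lifting K \<kappa> (insert None (Some ` cycles)) None (case_option Q (\<lambda>_. 5))
    (case_option g coeff) (case_option (\<lambda>_ _. 0) shift)"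
proof
  show "finite (insert None (Some ` cycles))" using finite_cycles by simp
  show "None \<in> insert None (Some ` cycles)" by simp
  show "modulus_ok (case i of None \<Rightarrow> Q | Some _ \<Rightarrow> 5)" for i :: "('k \<times> 'k \<times> 'k \<times> 'k) option"
    using Q by (cases i) (auto simp: modulus_ok_def)
  show "\<bar>(case i of None \<Rightarrow> g | Some m \<Rightarrow> coeff m) a b\<bar> \<in> {1, 2}" for i a b
    using g[of a b] weight by (cases i) (auto simp: abs_coeff)
  show "(case i of None \<Rightarrow> \<lambda>_ _. 0 | Some m \<Rightarrow> shift m) a b = (case i of None \<Rightarrow> \<lambda>_ _. 0 | Some m \<Rightarrow> shift m) b a" for i a b
    by (cases i) (auto simp: shift_def insert_commute)
  show "\<bar>(case i of None \<Rightarrow> g | Some m \<Rightarrow> coeff m) a b\<bar> \<noteq> \<bar>(case i of None \<Rightarrow> g | Some m \<Rightarrow> coeff m) a c\<bar>"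
    if "i \<in> insert None (Some ` cycles)" "a \<in> K" "b \<in> K" "c \<in> K" "distinct [a, b, c]" "\<kappa> a b = \<kappa> a c"
    for i a b c
    using that g_cherry[OF that(2-6)] g[of a b] g[of a c] weight_cherry[OF _ that(2-6)]
    by (cases i) (auto simp: abs_coeff)
  show "\<bar>(case None of None \<Rightarrow> g | Some m \<Rightarrow> coeff m) a b\<bar> \<noteq> \<bar>(case None of None \<Rightarrow> g | Some m \<Rightarrow> coeff m) b a\<bar>"
    if "a \<in> K" "b \<in> K" "a \<noteq> b" for a b
    using g_antisym[OF that] g[of a b] g[of b a] by auto
  fix a b c d
  assume *: "a \<in> K" "b \<in> K" "c \<in> K" "d \<in> K" "distinct [a, b, c, d]" "\<kappa> a b = \<kappa> c d" "\<kappa> b c = \<kappa> d a"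
  let ?m = "(a, b, c, d)"
  have "?m \<in> cycles" using * by (auto simp: cycles_def)
  moreover have "coeff ?m a b = 1" "coeff ?m a d = -1" "coeff ?m b a = 1" "coeff ?m b c = 1"
    "coeff ?m c d = 1" "coeff ?m c b = -1" "coeff ?m d c = 1" "coeff ?m d a = 1"
    using *(5) by (auto simp: coeff_def weight_def sides_def)
  moreover have "shift ?m a b = 1" "shift ?m b c = 0" "shift ?m c d = 0" "shift ?m d a = 0"
    using *(5) by (auto simp: shift_def doubleton_eq_iff)
  ultimately show "\<exists>i\<in>insert None (Some ` cycles).
      (case i of None \<Rightarrow> g | Some m \<Rightarrow> coeff m) a b = - (case i of None \<Rightarrow> g | Some m \<Rightarrow> coeff m) a d
    \<and> (case i of None \<Rightarrow> g | Some m \<Rightarrow> coeff m) b a = (case i of None \<Rightarrow> g | Some m \<Rightarrow> coeff m) b c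
    \<and> (case i of None \<Rightarrow> g | Some m \<Rightarrow> coeff m) c d = - (case i of None \<Rightarrow> g | Some m \<Rightarrow> coeff m) c b
    \<and> (case i of None \<Rightarrow> g | Some m \<Rightarrow> coeff m) d c = (case i of None \<Rightarrow> g | Some m \<Rightarrow> coeff m) d a
    \<and> \<not> (case i of None \<Rightarrow> Q | Some _ \<Rightarrow> 5) dvd
        (case i of None \<Rightarrow> \<lambda>_ _. 0 | Some m \<Rightarrow> shift m) a b
      - (case i of None \<Rightarrow> \<lambda>_ _. 0 | Some m \<Rightarrow> shift m) b c
      - (case i of None \<Rightarrow> \<lambda>_ _. 0 | Some m \<Rightarrow> shift m) c d
      + (case i of None \<Rightarrow> \<lambda>_ _. 0 | Some m \<Rightarrow> shift m) d a"
    by (intro bexI[of _ "Some ?m"]) auto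
qed

text \<open>The last summand does not depend on \<open>Q\<close>: it counts colours of edges whose ends have the same
  residue modulo \<open>Q\<close>.\<close>

lemma erdos_gyarfas_4_5_le:
  assumes \<kappa>: "\<And>a b. a \<in> K \<Longrightarrow> b \<in> K \<Longrightarrow> a \<noteq> b \<Longrightarrow> \<kappa> a b \<in> T" "finite T"
    and Q: "modulus_ok Q" and n: "n \<le> card K * (nat Q * 5 ^ card cycles)"
  shows "erdos_gyarfas n 4 5 \<le> (card T + 4) * (nat Q * 5 ^ card cycles) + card K * 2 ^ (5 ^ card cycles)"
proof -
  interpret L: lifting K \<kappa> "insert None (Some ` cycles)" None "case_option Q (\<lambda>_. 5)"
    "case_option g coeff" "case_option (\<lambda>_ _. 0) shift"
    by (rule lifting[OF Q])
  have 1: "(\<Prod>i\<in>Some ` cycles. nat (case i of None \<Rightarrow> Q | Some _ \<Rightarrow> 5)) = 5 ^ card cycles"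
    by (simp add: prod.reindex)
  have 2: "(\<Prod>i\<in>insert None (Some ` cycles). nat (case i of None \<Rightarrow> Q | Some _ \<Rightarrow> 5)) = nat Q * 5 ^ card cycles"
    by (subst prod.insert) (auto simp: 1 finite_cycles)
  have 3: "insert None (Some ` cycles) - {None} = Some ` cycles" by auto
  show ?thesis
    using L.erdos_gyarfas_lifting_le[of n T] n \<kappa> unfolding 2 3 1 by blast
qed

end

section \<open>A pattern from the Bose construction\<close>

text \<open>The triples \<open>{(x, i), (x + d, i + 1), (x - d, i + 1)}\<close> are those of Bose's Steiner triple systems on
  \<open>\<int>/w \<times> \<int>/3\<close>. Each is coloured as a cherry with apex \<open>(x, i)\<close>; its third edge is coloured by the sum \<open>2 x\<close>
  of the first coordinates. For \<open>w = 3 ^ r\<close> the digit of \<open>x\<close> at the lowest nonzero position of \<open>d\<close>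
  takes three different values on \<open>x\<close>, \<open>x + d\<close>, \<open>x - d\<close>; so the triples with given \<open>\<plusminus>d\<close> and given digit of the apex
  partition all points.\<close>

definition bose_colour :: "int \<Rightarrow> int \<times> int \<Rightarrow> int \<times> int \<Rightarrow> int \<times> int" where
  "bose_colour w = (\<lambda>(x, i) (y, j).
    if 3 dvd i - j then (0, (x + y) mod w)
    else if x = y then (1, i + j)
    else let d = min ((x - y) mod w) ((y - x) mod w) in
      (2 + ((if 3 dvd j - i - 1 then x else y) div gcd d w) mod 3, d))"

text \<open>The legs of a cherry have opposite differences, on different sides of
  \<open>w / 2\<close>; an edge seen from its other end gets the other value.\<close>

definition bose_orient :: "int \<Rightarrow> int \<times> int \<Rightarrow> int \<times> int \<Rightarrow> int" where
  "bose_orient w = (\<lambda>(x, i) (y, j).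
    if 3 dvd i - j then (if x < y then 1 else 2)
    else if 3 dvd j - i - 1 then (if 2 * ((y - x) mod w) < w then 1 else 2)
    else (if 2 * ((x - y) mod w) < w then 2 else 1))"

definition bose_points :: "int \<Rightarrow> (int \<times> int) set" where
  "bose_points w = {0..<w} \<times> {0..<3}"

text \<open>\<open>gcd d w\<close> is the place of the lowest nonzero ternary digit of
  \<open>d\<close>. Adding \<open>k * d\<close> shifts the digit there by a nonzero amount modulo 3
  without a carry from below, and reduction modulo \<open>w\<close> does not affect it.\<close>

lemma ternary_digit_neq:
  fixes w d x y k :: int
  assumes w: "w = 3 ^ r" and d: "\<not> w dvd d" and k: "\<not> 3 dvd k" and dvd: "w dvd (y - x) - k * d"
  shows "(x div gcd d w) mod 3 \<noteq> (y div gcd d w) mod 3"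
proof -
  define P where "P = gcd d w"
  have "P dvd 3 ^ r" by (simp add: P_def w)
  moreover have "prime (3::int)" by simp
  moreover have "0 \<le> P" by (simp add: P_def)
  ultimately obtain v where v: "v \<le> r" "P = 3 ^ v"
    using divides_primepow_weak[of 3 P r] by auto
  have "P dvd d" by (simp add: P_def)
  then have "v \<noteq> r" using v d w by auto
  then have 3: "3 * P dvd w" using v w le_imp_power_dvd[of "Suc v" r "3::int"] by auto
  have "P dvd w" by (simp add: P_def)
  then have "P dvd (y - x) - k * d + k * d" using dvd \<open>P dvd d\<close> by (meson dvd_add dvd_mult dvd_trans)
  then obtain u where u: "y - x = P * u" by auto
  obtain e where e: "d = P * e" using \<open>P dvd d\<close> by auto
  have P0: "P > 0" using v by simp
  have "\<not> 3 dvd u"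
  proof
    assume "3 dvd u"
    then have "3 * P dvd y - x" using u by auto
    then have "3 * P dvd (y - x) - ((y - x) - k * d)" using dvd_trans[OF 3 dvd] by (rule dvd_diff)
    then have "P * 3 dvd P * (k * e)" using e by (simp add: algebra_simps)
    then have "3 dvd k * e" using P0 by simp
    then have "3 dvd e" using k \<open>prime 3\<close> prime_dvd_mult_iff by blast
    then have "3 * P dvd d" using e by auto
    then have "3 * P dvd P" unfolding P_def using 3 by (simp add: P_def)
    then show False using P0 zdvd_imp_le by fastforce
  qed
  have "y = x + P * u" using u by simp
  then have "y div P = x div P + u" using P0 by simp
  moreover have "a mod 3 \<noteq> (a + u) mod 3" for a
    using \<open>\<not> 3 dvd u\<close> by presburger
  ultimately show ?thesis unfolding P_def[symmetric] by simp
qed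

locale bose =
  fixes w :: int and r :: nat
  assumes w: "w = 3 ^ r"
begin

lemma w_pos: "0 < w" and w_odd: "odd w"
  by (auto simp: w)

abbreviation K where "K \<equiv> bose_points w"
abbreviation \<kappa> where "\<kappa> \<equiv> bose_colour w"

lemma eq_of_dvd:
  assumes "x \<in> {0..<w}" "y \<in> {0..<w}" "w dvd x - y"
  shows "x = y"
proof -
  have "\<bar>x - y\<bar> < \<bar>w\<bar>" using assms by auto
  then show ?thesis using dvd_imp_le_int[of "x - y" w] assms(3) by fastforce
qed

lemma eq_of_dvd2:
  assumes "x \<in> {0..<w}" "y \<in> {0..<w}" "w dvd 2 * x - 2 * y"
  shows "x = y"
proof (rule eq_of_dvd[OF assms(1,2)])
  have "coprime w 2" using w_odd by simp
  then show "w dvd x - y"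
    using assms(3) coprime_dvd_mult_right_iff[of w 2 "x - y"] by (simp add: right_diff_distrib)
qed

lemma mod_neg_sum:
  assumes "\<not> w dvd d"
  shows "d mod w + (- d) mod w = w" "0 < d mod w" "d mod w < w"
  using assms w_pos pos_mod_bound[of w d] pos_mod_sign[of w d] by (auto simp: zmod_zminus1_eq_if dvd_eq_mod_eq_0 order_less_le)

lemma min_residue:
  assumes "x \<in> {0..<w}" "y \<in> {0..<w}" "x \<noteq> y" "d = min ((x - y) mod w) ((y - x) mod w)"
  shows "w dvd (y - x) - d \<or> w dvd (y - x) + d" "0 < d" "2 * d < w" "\<not> w dvd d"
proof -
  have n: "\<not> w dvd x - y" using eq_of_dvd assms by blast
  have eq: "(y - x) mod w = w - (x - y) mod w" "0 < (x - y) mod w" "(x - y) mod w < w"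
    using mod_neg_sum[OF n] by auto
  have half: "2 * ((x - y) mod w) \<noteq> w" using w_odd by (metis dvd_triv_left)
  show d: "0 < d" "2 * d < w"
    using eq half assms(4) by (auto simp: min_def)
  then show "\<not> w dvd d" using zdvd_imp_le[of w d] by auto
  have "d = (x - y) mod w \<or> d = (y - x) mod w" using assms(4) by (auto simp: min_def)
  moreover have "w dvd (y - x) - (y - x) mod w" "w dvd (x - y) - (x - y) mod w" by auto
  ultimately show "w dvd (y - x) - d \<or> w dvd (y - x) + d"
    by (metis dvd_minus_iff minus_diff_eq diff_minus_eq_add uminus_add_conv_diff add.commute minus_add_distrib diff_conv_add_uminus)
qed

lemma bose_colour_sym: "\<kappa> p q = \<kappa> q p"
proof -
  obtain x i y j where p: "p = (x, i)" "q = (y, j)" by (metis surj_pair)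
  have "3 dvd i - j \<longleftrightarrow> 3 dvd j - i" by presburger
  moreover have "3 dvd i - j - 1 \<longleftrightarrow> \<not> 3 dvd j - i - 1" if "\<not> 3 dvd i - j" using that by presburger
  ultimately show ?thesis
    by (auto simp: p bose_colour_def add.commute min.commute Let_def)
qed

text \<open>Edges inside a level and edges over one \<open>x\<close> are properly coloured.
  Otherwise both edges have the same \<open>d\<close>, and \<open>x\<close>, \<open>x + d\<close>,
  \<open>x - d\<close> have different digits; so equal digits must be read at the common end, which
  puts \<open>y\<close> and \<open>y'\<close> one level up at \<open>x + d\<close> and
  \<open>x - d\<close>.\<close>

lemma bose_cherry:
  assumes K: "(x, i) \<in> K" "(y, j) \<in> K" "(y', j') \<in> K"
    and dist: "distinct [(x, i), (y, j), (y', j')]"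
    and eq: "\<kappa> (x, i) (y, j) = \<kappa> (x, i) (y', j')"
  shows "3 dvd j - i - 1" "j = j'" "w dvd y + y' - 2 * x" "x \<noteq> y" "x \<noteq> y'"
proof -
  have r: "x \<in> {0..<w}" "y \<in> {0..<w}" "y' \<in> {0..<w}" "i \<in> {0..<3}" "j \<in> {0..<3}" "j' \<in> {0..<3}"
    using K by (auto simp: bose_points_def)
  have lvl: "a = b" if "3 dvd a - b" "a \<in> {0..<3}" "b \<in> {0..<3}" for a b :: int
    using that by auto presburger
  have fst: "fst (\<kappa> (x, i) (y, j)) = (if 3 dvd i - j then 0 else if x = y then 1 else
      2 + ((if 3 dvd j - i - 1 then x else y) div gcd (min ((x - y) mod w) ((y - x) mod w)) w) mod 3)" for x i y j
    by (simp add: bose_colour_def Let_def)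
  have nonneg: "2 + (a::int) mod 3 \<noteq> 0" "2 + (a::int) mod 3 \<noteq> 1" for a
    using pos_mod_sign[of 3 a] by linarith+
  note nonneg' = nonneg nonneg[symmetric]
  have ij: "\<not> 3 dvd i - j"
  proof
    assume *: "3 dvd i - j"
    then have **: "3 dvd i - j'"
      using arg_cong[OF eq, of fst] nonneg' unfolding fst by (auto split: if_splits)
    then have "(x + y) mod w = (x + y') mod w"
      using eq * by (simp add: bose_colour_def)
    then have "y = y'" using eq_of_dvd[OF r(2,3)] by (simp add: mod_eq_dvd_iff)
    moreover have "j = j'" using * ** lvl r by metis
    ultimately show False using dist by simp
  qed
  have ij': "\<not> 3 dvd i - j'"
    using arg_cong[OF eq, of fst] nonneg' ij unfolding fst by (auto split: if_splits)
  have xy: "x \<noteq> y"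
  proof
    assume "x = y"
    moreover from this have "x = y'"
      using arg_cong[OF eq, of fst] nonneg' ij ij' unfolding fst by (auto split: if_splits)
    ultimately show False using eq ij ij' dist by (auto simp: bose_colour_def)
  qed
  have xy': "x \<noteq> y'"
    using arg_cong[OF eq, of fst] nonneg' ij ij' xy unfolding fst by (auto split: if_splits)
  define d where "d = min ((x - y) mod w) ((y - x) mod w)"
  have d': "d = min ((x - y') mod w) ((y' - x) mod w)"
    using eq ij ij' xy xy' by (simp add: bose_colour_def d_def Let_def)
  have dig: "((if 3 dvd j - i - 1 then x else y) div gcd d w) mod 3 = ((if 3 dvd j' - i - 1 then x else y') div gcd d w) mod 3"
    using eq ij ij' xy xy' by (simp add: bose_colour_def d_def[symmetric] d'[symmetric] Let_def)
  note D = min_residue[OF r(1,2) xy d_def] and D' = min_residue(1)[OF r(1,3) xy' d']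
  have digit: "(a div gcd d w) mod 3 \<noteq> (b div gcd d w) mod 3"
    if "w dvd (b - a) - k * d" "k \<in> {1, -1, 2, -2}" for a b k
    by (rule ternary_digit_neq[OF w D(4) _ that(1)]) (use that(2) in auto)
  have yy': "w dvd (y' - y) - 0 * d \<or> w dvd (y' - y) - 2 * d \<or> w dvd (y' - y) - (-2) * d"
    using D(1) D' dvd_diff[of w "(y' - x) - d" "(y - x) - d"] dvd_diff[of w "(y' - x) + d" "(y - x) - d"]
      dvd_diff[of w "(y' - x) - d" "(y - x) + d"] dvd_diff[of w "(y' - x) + d" "(y - x) + d"]
    by (auto simp: algebra_simps)
  show up: "3 dvd j - i - 1"
  proof (rule ccontr)
    assume n: "\<not> 3 dvd j - i - 1"
    show False
    proof (cases "3 dvd j' - i - 1")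
      case True
      have "w dvd (y - x) - 1 * d \<or> w dvd (y - x) - (-1) * d" using D(1) by simp
      then show False using digit[of y x 1] digit[of y x "-1"] dig n True by auto
    next
      case False
      then have "j = j'" using n r ij ij' by (intro lvl) presburger+
      then have "y \<noteq> y'" using dist by simp
      then have "\<not> w dvd (y' - y) - 0 * d" using eq_of_dvd[OF r(3,2)] by auto
      then show False using yy' digit[of y' y 2] digit[of y' y "-2"] dig n False by auto
    qed
  qed
  have up': "3 dvd j' - i - 1"
  proof (rule ccontr)
    assume n: "\<not> 3 dvd j' - i - 1"
    have "w dvd (y' - x) - 1 * d \<or> w dvd (y' - x) - (-1) * d" using D' by simp
    then show False using digit[of y' x 1] digit[of y' x "-1"] dig up n by auto
  qed
  show jj: "j = j'" using up up' r by (intro lvl) presburger+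
  then have "y \<noteq> y'" using dist by simp
  then have "\<not> w dvd y' - y" using eq_of_dvd[OF r(3,2)] by auto
  then show "w dvd y + y' - 2 * x"
    using D(1) D' dvd_diff[of w "(y' - x) - d" "(y - x) - d"] dvd_add[of w "(y' - x) + d" "(y - x) - d"]
      dvd_add[of w "(y' - x) - d" "(y - x) + d"] dvd_diff[of w "(y' - x) + d" "(y - x) + d"]
    by (auto simp: algebra_simps)
  show "x \<noteq> y" "x \<noteq> y'" by fact+
qed

lemma bose_cherry':
  assumes "p \<in> K" "q \<in> K" "t \<in> K" "distinct [p, q, t]" "\<kappa> p q = \<kappa> p t"
  shows "3 dvd snd q - snd p - 1" "snd q = snd t" "w dvd fst q + fst t - 2 * fst p" "fst p \<noteq> fst q"
  using bose_cherry[of "fst p" "snd p" "fst q" "snd q" "fst t" "snd t", unfolded prod.collapse] assms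
  by blast+

lemma K_eqI:
  assumes "p \<in> K" "q \<in> K" "w dvd fst p - fst q" "snd p = snd q"
  shows "p = q"
  using assms eq_of_dvd[of "fst p" "fst q"] by (auto simp: bose_points_def prod_eq_iff)

lemma bose_colour_base:
  assumes "snd p = snd q"
  shows "\<kappa> p q = (0, (fst p + fst q) mod w)"
  using assms by (simp add: bose_colour_def case_prod_beta)

lemma fst_bose_colour_base:
  assumes "fst (\<kappa> p q) = 0" "p \<in> K" "q \<in> K"
  shows "snd p = snd q"
proof -
  have "2 + (a::int) mod 3 \<noteq> 0" for a using pos_mod_sign[of 3 a] by linarith
  then have "3 dvd snd p - snd q"
    using assms(1) by (auto simp: bose_colour_def case_prod_beta Let_def split: if_splits)
  moreover have "snd p \<in> {0..<3}" "snd q \<in> {0..<3}" using assms by (auto simp: bose_points_def)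
  ultimately show ?thesis by auto presburger
qed

text \<open>The level conditions of \<open>bose_cherry'\<close> exclude most coincidences. Of the
  others, the base colour \<open>2 x\<close> on \<open>a d\<close> would force \<open>d = a\<close>,
  and two apexes over one base agree because \<open>w\<close> is odd.\<close>

lemma bose_star:
  assumes K: "a \<in> K" "b \<in> K" "c \<in> K" "d \<in> K" and dist: "distinct [a, b, c, d]"
    and eq: "\<kappa> a b = \<kappa> a c"
  shows "distinct [\<kappa> a b, \<kappa> b c, \<kappa> a d, \<kappa> b d, \<kappa> c d]"
proof -
  have abc: "3 dvd snd b - snd a - 1" "snd b = snd c" "w dvd fst b + fst c - 2 * fst a" "fst a \<noteq> fst b"
    using bose_cherry'[OF K(1-3)] dist eq by auto
  have lvl: "snd a \<noteq> snd b" "\<not> 3 dvd snd a - snd b - 1" using abc(1) by presburger+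
  note sym = bose_colour_sym
  note ch = bose_cherry'
  have bc: "\<kappa> b c = (0, (fst b + fst c) mod w)" using abc(2) by (rule bose_colour_base)
  have 1: "\<kappa> a b \<noteq> \<kappa> b c"
    using fst_bose_colour_base[OF _ K(1,2)] lvl bc by auto
  have 2: "\<kappa> a b \<noteq> \<kappa> a d"
  proof
    assume "\<kappa> a b = \<kappa> a d"
    then have "snd b = snd d" "w dvd fst b + fst d - 2 * fst a"
      using ch[OF K(1,2,4)] dist by auto
    moreover have "w dvd (fst b + fst c - 2 * fst a) - (fst b + fst d - 2 * fst a)"
      using abc(3) calculation(2) by (rule dvd_diff)
    ultimately have "c = d" using abc(2) by (intro K_eqI K) simp_all
    then show False using dist by simp
  qed
  have 3: "\<kappa> a b \<noteq> \<kappa> b d"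
    using ch(1)[OF K(2,1,4)] dist lvl sym[of a b] by auto
  have 4: "\<kappa> a c \<noteq> \<kappa> c d"
    using ch(1)[OF K(3,1,4)] dist lvl abc(2) sym[of a c] by auto
  have 5: "\<kappa> b c \<noteq> \<kappa> a d"
  proof
    assume *: "\<kappa> b c = \<kappa> a d"
    then have "fst (\<kappa> a d) = 0" using bc by (metis fst_conv)
    then have ad: "snd a = snd d" by (rule fst_bose_colour_base[OF _ K(1,4)])
    then have "(fst a + fst d) mod w = (fst b + fst c) mod w"
      using * bc bose_colour_base[OF ad] by simp
    then have "w dvd (fst a + fst d) - (fst b + fst c)" by (simp add: mod_eq_dvd_iff)
    then have "w dvd ((fst a + fst d) - (fst b + fst c)) + (fst b + fst c - 2 * fst a)"
      using abc(3) by (rule dvd_add)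
    then have "d = a" using ad by (intro K_eqI K) simp_all
    then show False using dist by simp
  qed
  have 6: "\<kappa> b c \<noteq> \<kappa> b d"
    using ch(1)[OF K(2,3,4)] dist abc(2) by auto
  have 7: "\<kappa> b c \<noteq> \<kappa> c d"
    using ch(1)[OF K(3,2,4)] dist abc(2) sym[of b c] by auto
  have 8: "\<kappa> a d \<noteq> \<kappa> b d"
    using ch(2)[OF K(4,1,2)] dist lvl sym[of a d] sym[of b d] by auto
  have 9: "\<kappa> a d \<noteq> \<kappa> c d"
    using ch(2)[OF K(4,1,3)] dist lvl abc(2) sym[of a d] sym[of c d] by auto
  have 10: "\<kappa> b d \<noteq> \<kappa> c d"
  proof
    assume "\<kappa> b d = \<kappa> c d"
    then have "3 dvd snd b - snd d - 1" "w dvd fst b + fst c - 2 * fst d"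
      using ch[OF K(4,2,3)] dist sym[of b d] sym[of c d] by auto
    moreover have "w dvd (fst b + fst c - 2 * fst d) - (fst b + fst c - 2 * fst a)"
      using calculation(2) abc(3) by (rule dvd_diff)
    then have "fst a = fst d" using K eq_of_dvd2 by (auto simp: bose_points_def)
    moreover have "snd a = snd d"
      using abc(1) calculation(1) K(1,4) by (auto simp: bose_points_def) presburger
    ultimately have "a = d" by (simp add: prod_eq_iff)
    then show False using dist by simp
  qed
  show ?thesis using 1 2 3 4[folded eq] 5 6 7 8 9 10 by simp
qed

lemma oriented_pattern: "oriented_pattern K \<kappa> (bose_orient w)"
proof
  show "finite K" by (simp add: bose_points_def)
  show "\<kappa> a b = \<kappa> b a" for a b by (rule bose_colour_sym)
  show "bose_orient w a b \<in> {1, 2}" for a b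
    by (auto simp: bose_orient_def case_prod_beta)
  show "\<kappa> b c \<noteq> \<kappa> a b" if "a \<in> K" "b \<in> K" "c \<in> K" "distinct [a, b, c]" "\<kappa> a b = \<kappa> a c" for a b c
  proof -
    note ch = bose_cherry'[OF that]
    have "snd a \<noteq> snd b" using ch(1) by presburger
    then show ?thesis
      using fst_bose_colour_base[OF _ that(1,2)] bose_colour_base[OF ch(2)] by (metis fst_conv)
  qed
  show "distinct [\<kappa> a b, \<kappa> b c, \<kappa> a d, \<kappa> b d, \<kappa> c d]"
    if "a \<in> K" "b \<in> K" "c \<in> K" "d \<in> K" "distinct [a, b, c, d]" "\<kappa> a b = \<kappa> a c" for a b c d
    using that by (rule bose_star)
  show "bose_orient w a b \<noteq> bose_orient w b a" if "a \<in> K" "b \<in> K" "a \<noteq> b" for a b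
  proof -
    have "3 dvd snd a - snd b \<longleftrightarrow> 3 dvd snd b - snd a" by presburger
    moreover have "3 dvd snd a - snd b - 1 \<longleftrightarrow> \<not> 3 dvd snd b - snd a - 1" if "\<not> 3 dvd snd a - snd b"
      using that by presburger
    moreover have "fst a \<noteq> fst b" if "3 dvd snd a - snd b"
    proof -
      have "snd a = snd b" using that \<open>a \<in> K\<close> \<open>b \<in> K\<close> by (auto simp: bose_points_def) presburger
      then show ?thesis using \<open>a \<noteq> b\<close> by (simp add: prod_eq_iff)
    qed
    ultimately show ?thesis by (auto simp: bose_orient_def case_prod_beta)
  qed
  show "bose_orient w a b \<noteq> bose_orient w a c"
    if "a \<in> K" "b \<in> K" "c \<in> K" "distinct [a, b, c]" "\<kappa> a b = \<kappa> a c" for a b c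
  proof -
    note ch = bose_cherry'[OF that]
    have up: "3 dvd snd b - snd a - 1" "\<not> 3 dvd snd a - snd b" "snd c = snd b" using ch(1,2) by presburger+
    let ?d = "fst b - fst a"
    have "\<not> w dvd ?d"
      using eq_of_dvd[of "fst b" "fst a"] ch(4) that(1,2) by (auto simp: bose_points_def)
    note m = mod_neg_sum[OF this]
    have "(fst c - fst a) mod w = (- ?d) mod w"
      using ch(3) by (simp add: mod_eq_dvd_iff algebra_simps)
    then have "bose_orient w a b = (if 2 * (?d mod w) < w then 1 else 2)"
      "bose_orient w a c = (if 2 * ((- ?d) mod w) < w then 1 else 2)"
      using up by (simp_all add: bose_orient_def case_prod_beta)
    moreover have "2 * (?d mod w) \<noteq> w" using w_odd by (metis dvd_triv_left)
    then have "2 * (?d mod w) < w \<longleftrightarrow> \<not> 2 * ((- ?d) mod w) < w" using m(1) by linarith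
    ultimately show ?thesis by simp
  qed
qed

section \<open>Counting the colours of the pattern\<close>

text \<open>The blocks have sizes \<open>w\<close>, 3 and \<open>3 * (w - 1) / 2\<close>: about
  \<open>5 w / 2\<close> colours on \<open>3 w\<close> points, whence the constant 5/6.\<close>

definition palette :: "(int \<times> int) set" where
  "palette = {0} \<times> {0..<w} \<union> {1} \<times> {1..3} \<union> {2..4} \<times> {1..(w - 1) div 2}"

lemma bose_colour_in_palette:
  assumes "a \<in> K" "b \<in> K" "a \<noteq> b"
  shows "\<kappa> a b \<in> palette"
proof -
  obtain x i y j where p: "a = (x, i)" "b = (y, j)" by (metis surj_pair)
  have r: "x \<in> {0..<w}" "y \<in> {0..<w}" "i \<in> {0..<3}" "j \<in> {0..<3}"
    using assms by (auto simp: p bose_points_def)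
  define d where "d = min ((x - y) mod w) ((y - x) mod w)"
  consider "3 dvd i - j" | "\<not> 3 dvd i - j" "x = y" | "\<not> 3 dvd i - j" "x \<noteq> y" by blast
  then show ?thesis
  proof cases
    case 1
    then show ?thesis using w_pos by (simp add: p bose_colour_def palette_def)
  next
    case 2
    then have "i + j \<in> {1..3}" using r by auto presburger+
    then show ?thesis using 2 by (simp add: p bose_colour_def palette_def)
  next
    case 3
    have "0 < d" "2 * d < w" using min_residue[OF r(1,2) 3(2) d_def] by auto
    then have "d \<in> {1..(w - 1) div 2}" by auto
    moreover have "2 + k mod 3 \<in> {2..4}" for k :: int
      using pos_mod_sign[of 3 k] pos_mod_bound[of 3 k] by auto
    moreover have "\<kappa> a b = (2 + ((if 3 dvd j - i - 1 then x else y) div gcd d w) mod 3, d)"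
      using 3 by (simp add: p bose_colour_def d_def Let_def)
    ultimately show ?thesis
      unfolding palette_def by (metis SigmaI UnI2)
  qed
qed

lemma finite_palette: "finite palette"
  and card_palette: "2 * card palette \<le> 5 * nat w + 3"
proof -
  show "finite palette" by (simp add: palette_def)
  have "card palette \<le> card ({0::int} \<times> {0..<w}) + card ({1::int} \<times> {1..3::int}) + card ({2..4::int} \<times> {1..(w - 1) div 2})"
    unfolding palette_def by (intro order.trans[OF card_Un_le] add_mono) auto
  also have "\<dots> = nat w + 3 + 3 * nat ((w - 1) div 2)"
    by (simp add: card_cartesian_product)
  finally have le: "card palette \<le> nat w + 3 + 3 * nat ((w - 1) div 2)" .
  obtain k where "w = 2 * k + 1" using w_odd by (auto elim: oddE)
  with w_pos le show "2 * card palette \<le> 5 * nat w + 3" by simp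
qed

lemma card_K: "card K = 3 * nat w"
  by (simp add: bose_points_def card_cartesian_product)

text \<open>\<open>n\<close> is rounded up to the size of a blow-up; the rounding and the
  \<open>Fibre\<close> colours cost a constant that does not depend on \<open>n\<close>.\<close>

lemma erdos_gyarfas_bose_le:
  "\<exists>c. \<forall>n. real (erdos_gyarfas n 4 5) \<le> (5 / 6 + 2 / of_int w) * real n + c"
proof -
  interpret P: oriented_pattern K \<kappa> "bose_orient w" by (rule oriented_pattern)
  define M :: nat where "M = 5 ^ card P.cycles"
  define B where "B = 3 * nat w * M"
  define t where "t = card palette + 4"
  define e where "e = 3 * nat w * 2 ^ M"
  have M: "0 < M" "0 < B" using w_pos by (simp_all add: M_def B_def)
  have t: "real (t * M) \<le> (5 / 6 + 2 / of_int w) * real B"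
  proof -
    \<comment> \<open>With the four labels of \<open>Inner\<close> this gives the ratio
      \<open>5 / 6 + 11 / (6 w)\<close>, and 11/6 is rounded up to 2.\<close>
    have "2 * t \<le> 5 * nat w + 11" using card_palette by (simp add: t_def)
    then have "real (2 * t) \<le> real (5 * nat w + 11)" by (simp only: of_nat_le_iff)
    moreover have "(5 / 6 + 2 / of_int w) * (3 * of_int w) = 5 / 2 * of_int w + (6 :: real)"
      using w_pos by (simp add: field_simps)
    ultimately have "real t \<le> (5 / 6 + 2 / of_int w) * (3 * of_int w)"
      using w_pos by simp
    then have "real t * real M \<le> (5 / 6 + 2 / of_int w) * (3 * of_int w) * real M"
      by (rule mult_right_mono) simp
    then show ?thesis using w_pos by (simp add: B_def algebra_simps)
  qed
  have "real (erdos_gyarfas n 4 5) \<le> (5 / 6 + 2 / of_int w) * real n + (real (t * M) * 7 + real e)" for n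
  proof -
    \<comment> \<open>The least \<open>m\<close> with \<open>n < 6 * B * m\<close>; then
      \<open>6 * m + 1\<close> is coprime to 6 and large enough.\<close>
    define m where "m = n div (6 * B) + 1"
    define Q where "Q = 6 * m + 1"
    have "int Q = 6 * int m + 1" by (simp add: Q_def)
    then have "0 < int Q" "odd (int Q)" "\<not> 3 dvd int Q" by presburger+
    then have Q: "modulus_ok (int Q)" unfolding modulus_ok_def by (intro conjI)
    have "n < 6 * B * m"
      using dividend_less_times_div[of "6 * B" n] M by (simp add: m_def algebra_simps)
    also have "6 * B * m \<le> B * Q" by (simp add: Q_def algebra_simps)
    also have "B * Q = card K * (nat (int Q) * 5 ^ card P.cycles)"
      by (simp only: card_K B_def M_def nat_int mult_ac)
    finally have n: "n \<le> card K * (nat (int Q) * 5 ^ card P.cycles)" by simp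
    have "erdos_gyarfas n 4 5 \<le> (card palette + 4) * (nat (int Q) * 5 ^ card P.cycles)
        + card K * 2 ^ (5 ^ card P.cycles)"
      by (intro P.erdos_gyarfas_4_5_le bose_colour_in_palette finite_palette Q n)
    then have "erdos_gyarfas n 4 5 \<le> t * (Q * M) + e"
      by (simp only: card_K t_def M_def e_def nat_int)
    then have "real (erdos_gyarfas n 4 5) \<le> real (t * (Q * M) + e)" by (simp only: of_nat_le_iff)
    also have "\<dots> = real (t * M) * real Q + real e" by simp
    also have "real Q \<le> real n / real B + 7"
    proof -
      have "6 * B * (n div (6 * B)) \<le> n" by simp
      then have "real (6 * B * (n div (6 * B))) \<le> real n" by (simp only: of_nat_le_iff)
      then show ?thesis using M by (simp add: Q_def m_def field_simps)
    qed
    then have "real (t * M) * real Q \<le> real (t * M) * (real n / real B + 7)"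
      by (rule mult_left_mono) simp
    also have "\<dots> = real (t * M) * (real n / real B) + real (t * M) * 7" by (rule distrib_left)
    also have "real (t * M) * (real n / real B) \<le> (5 / 6 + 2 / of_int w) * real B * (real n / real B)"
      by (rule mult_right_mono[OF t]) simp
    also have "\<dots> = (5 / 6 + 2 / of_int w) * real n" using M by simp
    finally show ?thesis by simp
  qed
  then show ?thesis by blast
qed

end

section \<open>The limit\<close>

theorem theorem1:
  shows "(\<lambda>n. real (erdos_gyarfas n 4 5) / real n) \<longlonglongrightarrow> 5 / 6"
proof (rule LIMSEQ_I)
  fix \<epsilon> :: real
  assume \<epsilon>: "0 < \<epsilon>"
  \<comment> \<open>Makes the excess \<open>2 / w\<close> smaller than
    \<open>\<epsilon> / 2\<close>.\<close>
  obtain r where r: "4 / \<epsilon> < 3 ^ r" using real_arch_pow[of 3 "4 / \<epsilon>"] by auto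
  interpret bose "3 ^ r" r by unfold_locales simp
  obtain c where c: "\<And>n. real (erdos_gyarfas n 4 5) \<le> (5 / 6 + 2 / 3 ^ r) * real n + c"
    using erdos_gyarfas_bose_le by auto
  have r': "2 / 3 ^ r < \<epsilon> / 2" using r \<epsilon> by (simp add: field_simps)
  \<comment> \<open>The other half of \<open>\<epsilon>\<close> absorbs \<open>c\<close> and the
    loss of at most 1 in the lower bound.\<close>
  obtain m :: nat where m: "2 * (\<bar>c\<bar> + 1) / \<epsilon> < real m" using reals_Archimedean2 by blast
  show "\<exists>no. \<forall>n\<ge>no. norm (real (erdos_gyarfas n 4 5) / real n - 5 / 6) < \<epsilon>"
  proof (intro exI allI impI)
    fix n
    assume n: "max 4 m \<le> n"
    then have n0: "0 < real n" by simp
    have "2 * (\<bar>c\<bar> + 1) / \<epsilon> < real n" using m n by linarith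
    then have n1: "\<bar>c\<bar> + 1 < \<epsilon> / 2 * real n" using \<epsilon> by (simp add: field_simps)
    have "real (5 * (n - 1)) \<le> real (6 * erdos_gyarfas n 4 5)"
      using erdos_gyarfas_4_5_ge[of n] n by (simp only: of_nat_le_iff)
    then have lower: "5 / 6 * real n - 1 \<le> real (erdos_gyarfas n 4 5)" using n by (simp add: of_nat_diff)
    have "2 / 3 ^ r * real n \<le> \<epsilon> / 2 * real n" using r' by (intro mult_right_mono) auto
    then have upper: "real (erdos_gyarfas n 4 5) \<le> 5 / 6 * real n + \<epsilon> / 2 * real n + c"
      using c[of n] by (simp add: algebra_simps)
    have "\<bar>real (erdos_gyarfas n 4 5) - 5 / 6 * real n\<bar> < \<epsilon> * real n"
      unfolding abs_less_iff using lower upper n1 by linarith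
    moreover have "real (erdos_gyarfas n 4 5) / real n - 5 / 6 = (real (erdos_gyarfas n 4 5) - 5 / 6 * real n) / real n"
      using n0 by (simp add: field_simps)
    ultimately show "norm (real (erdos_gyarfas n 4 5) / real n - 5 / 6) < \<epsilon>"
      using n0 by (simp add: field_simps)
  qed
qed

end
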